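(* Let $m,n\ge 1$ be integers, let $E\in\mathbb{R}^{m\times m}$ be a non-zero symmetric positive semi-definite matrix, and let $z_1,\dots,z_n$ be independent random vectors in $\mathbb{R}^m$ with $\mathbb{E}[z_jz_j^T]=E$ for $1\le j\le n$. Suppose there is $L>0$ with $\max_{1\le j\le n}\|z_j\|_2\le L$ and $\|E\|_2\le L^2$. Set $\widehat{E}=\frac1n\sum_{j=1}^n z_jz_j^T$. Let $\lambda_1\ge\cdots\ge\lambda_m\ge 0$ be the eigenvalues of $E$ with corresponding orthonormal eigenvectors $v_1,\dots,v_m$, and let $\widehat\lambda_1\ge\cdots\ge\widehat\lambda_m\ge 0$ be the eigenvalues of $\widehat{E}$ with corresponding orthonormal eigenvectors $\widehat v_1,\dots,\widehat v_m$. Suppose that $\lambda_k-\lambda_{k+1}>0$ for some $1\le k<m$, so that $\mathcal{S}=\mathrm{range}\,(v_1\ \cdots\ v_k)$ is well-defined. Let $0<\epsilon<\frac{\lambda_k-\lambda_{k+1}}{4\|E\|_2}$ and $0<\delta<1$. If $$n\ge\frac{8}{3\epsilon^2}\,\frac{L^2}{\|E\|_2}\,\ln\left(\frac{4}{\delta}\,\mathrm{intdim}(E)\right),$$ then with probability at least $1-\delta$, the dominant subspace $\widehat{\mathcal{S}}=\mathrm{range}\,(\widehat v_1\ \cdots\ \widehat v_k)$ is well-defined (that is, $\widehat\lambda_k>\widehat\lambda_{k+1}$), and the largest principal angle $\angle(\widehat{\mathcal{S}},\mathcal{S})$ satisfies $$\sin\angle(\widehat{\mathcal{S}},\mathcal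{S})\le\frac{4\|E\|_2}{\lambda_k-\lambda_{k+1}}\,\epsilon.$$
   Context: $\|\cdot\|_2$ is the Euclidean norm for vectors and the spectral (operator two-) norm for matrices. For a non-zero symmetric positive semi-definite matrix $P$, the intrinsic dimension is $\mathrm{intdim}(P)=\mathrm{trace}(P)/\|P\|_2$. The random vectors $z_j$ are not assumed to be identically distributed. The dominant $k$-dimensional subspace (the span of eigenvectors for the $k$ largest eigenvalues) is called well-defined when there is a strict gap between the $k$-th and $(k+1)$-st largest eigenvalues. For subspaces $\mathcal{S},\widehat{\mathcal{S}}$ of the same dimension, the largest principal angle $\angle(\widehat{\mathcal{S}},\mathcal{S})\in[0,\pi/2]$ satisfies $\sin\angle(\widehat{\mathcal{S}},\mathcal{S})=\|\Pi_{\mathcal{S}}-\Pi_{\widehat{\mathcal{S}}}\|_2$, where $\Pi_{\mathcal{S}},\Pi_{\widehat{\mathcal{S}}}$ are the orthogonal projectors onto $\mathcal{S},\widehat{\mathcal{S}}$. *)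

theory Defs
  imports "HOL-Probability.Probability"
begin

text \<open>
  The library instance of \<open>norm\<close> on \<^typ>\<open>real^'m^'n\<close> is the Frobenius norm; the matrix two-norm
  is the operator norm of the associated linear map.
\<close>

definition spectral_norm :: "real^'m^'n \<Rightarrow> real" where
  "spectral_norm A = onorm (\<lambda>x. A *v x)"

definition sym_psd :: "real^'m^'m \<Rightarrow> bool" where
  "sym_psd A \<longleftrightarrow> transpose A = A \<and> (\<forall>x. 0 \<le> x \<bullet> (A *v x))"

definition intdim :: "real^'m^'m \<Rightarrow> real" where
  "intdim A = trace A / spectral_norm A"

definition outer :: "real^'n \<Rightarrow> real^'m \<Rightarrow> real^'m^'n" where
  "outer x y = (\<chi> i j. x $ i * y $ j)"

definition sample_second_moment :: "nat \<Rightarrow> (nat \<Rightarrow> real^'m) \<Rightarrow> real^'m^'m" where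
  "sample_second_moment n x = (1 / real n) *\<^sub>R (\<Sum>j = 1..n. outer (x j) (x j))"

text \<open>
  Indices run from \<open>1\<close> to the dimension; values outside this range are irrelevant. Since the
  \<open>v i\<close> form an orthonormal basis, \<open>l\<close> lists every eigenvalue with its multiplicity.
\<close>

definition ordered_eigensystem :: "real^'m^'m \<Rightarrow> (nat \<Rightarrow> real) \<Rightarrow> (nat \<Rightarrow> real^'m) \<Rightarrow> bool" where
  "ordered_eigensystem A l v \<longleftrightarrow>
     (\<forall>i\<in>{1..CARD('m)}. \<forall>j\<in>{1..CARD('m)}. i \<le> j \<longrightarrow> l j \<le> l i) \<and>
     (\<forall>i\<in>{1..CARD('m)}. A *v v i = l i *\<^sub>R v i) \<and>
     (\<forall>i\<in>{1..CARD('m)}. \<forall>j\<in>{1..CARD('m)}. v i \<bullet> v j = (if i = j then 1 else 0))"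

definition orth_proj :: "(real^'m) set \<Rightarrow> real^'m^'m" where
  "orth_proj S = matrix (\<lambda>x. THE y. y \<in> S \<and> (\<forall>w\<in>S. orthogonal (x - y) w))"

text \<open>
  The largest principal angle of two subspaces of equal dimension, as the unique angle in
  \<open>[0, \<pi>/2]\<close> whose sine is the two-norm distance of the orthogonal projectors.
\<close>

definition largest_principal_angle :: "(real^'m) set \<Rightarrow> (real^'m) set \<Rightarrow> real" where
  "largest_principal_angle S T =
     (THE \<theta>. 0 \<le> \<theta> \<and> \<theta> \<le> pi / 2 \<and> sin \<theta> = spectral_norm (orth_proj T - orth_proj S))"

lemma orth_proj_unique:
  fixes S :: "(real^'m) set"
  assumes S: "subspace S"
  shows "\<exists>!y. y \<in> S \<and> (\<forall>w\<in>S. orthogonal (x - y) w)"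
proof -
  have spS: "span S = S" using S by (simp add: span_eq_iff)
  obtain y z where y: "y \<in> span S" and z: "\<And>w. w \<in> span S \<Longrightarrow> orthogonal z w" and x: "x = y + z"
    using orthogonal_subspace_decomp_exists[of S x] by metis
  show ?thesis
  proof (rule ex1I[of _ y])
    show "y \<in> S \<and> (\<forall>w\<in>S. orthogonal (x - y) w)" using y z x spS by simp
    fix y' assume y': "y' \<in> S \<and> (\<forall>w\<in>S. orthogonal (x - y') w)"
    have d: "y - y' \<in> S" using y y' spS S subspace_diff by metis
    have "(x - y') \<bullet> (y - y') = 0" "(x - y) \<bullet> (y - y') = 0"
      using y' z x spS d by (auto simp: orthogonal_def)
    hence "(y - y') \<bullet> (y - y') = 0" by (simp add: inner_diff_left)
    thus "y' = y" by simp
  qed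
qed

lemma orth_proj_mult:
  fixes S :: "(real^'m) set"
  assumes S: "subspace S"
  shows "orth_proj S *v x \<in> S" "w \<in> S \<Longrightarrow> orthogonal (x - orth_proj S *v x) w"
proof -
  let ?f = "\<lambda>x. THE y. y \<in> S \<and> (\<forall>w\<in>S. orthogonal (x - y) w)"
  have P: "?f x \<in> S \<and> (\<forall>w\<in>S. orthogonal (x - ?f x) w)" for x
    using theI'[OF orth_proj_unique[OF S, of x]] .
  have eq: "?f x = y" if "y \<in> S" "\<forall>w\<in>S. orthogonal (x - y) w" for x y
    using that by (intro the1_equality orth_proj_unique[OF S]) auto
  have "linear ?f"
  proof (rule linearI)
    fix a b show "?f (a + b) = ?f a + ?f b"
    proof (rule eq)
      show "?f a + ?f b \<in> S" using P S subspace_add by blast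
      show "\<forall>w\<in>S. orthogonal (a + b - (?f a + ?f b)) w"
        using P[of a] P[of b] by (simp add: orthogonal_def inner_diff_left inner_add_left)
    qed
  next
    fix c a show "?f (c *\<^sub>R a) = c *\<^sub>R ?f a"
    proof (rule eq)
      show "c *\<^sub>R ?f a \<in> S" using P S subspace_scale by blast
      show "\<forall>w\<in>S. orthogonal (c *\<^sub>R a - c *\<^sub>R ?f a) w"
        using P[of a] by (simp add: orthogonal_def inner_diff_left)
    qed
  qed
  hence m: "orth_proj S *v x = ?f x" for x
    unfolding orth_proj_def by (simp add: matrix_works)
  show "orth_proj S *v x \<in> S" "w \<in> S \<Longrightarrow> orthogonal (x - orth_proj S *v x) w"
    using P[of x] by (auto simp: m)
qed

lemma spectral_norm_orth_proj_diff_le_1: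
  fixes S T :: "(real^'m) set"
  assumes S: "subspace S" and T: "subspace T"
  shows "spectral_norm (orth_proj T - orth_proj S) \<le> 1"
  unfolding spectral_norm_def
proof (rule onorm_bound)
  fix x :: "real^'m"
  define p where "p = orth_proj T *v x"
  define q where "q = orth_proj S *v x"
  have p: "p \<in> T" "\<And>w. w \<in> T \<Longrightarrow> (x - p) \<bullet> w = 0"
    unfolding p_def using orth_proj_mult[OF T] by (simp_all add: orthogonal_def)
  have q: "q \<in> S" "\<And>w. w \<in> S \<Longrightarrow> (x - q) \<bullet> w = 0"
    unfolding q_def using orth_proj_mult[OF S] by (simp_all add: orthogonal_def)
  have "norm (2 *\<^sub>R p - x) = norm x" "norm (2 *\<^sub>R q - x) = norm x"
    using p(2)[OF p(1)] q(2)[OF q(1)]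
    by (auto simp: norm_eq inner_diff_left inner_diff_right inner_commute)
  hence "norm ((2 *\<^sub>R p - x) - (2 *\<^sub>R q - x)) \<le> norm x + norm x"
    by (metis norm_triangle_ineq4)
  also have "(2 *\<^sub>R p - x) - (2 *\<^sub>R q - x) = 2 *\<^sub>R (p - q)" by (simp add: algebra_simps)
  finally have "norm (p - q) \<le> norm x" by simp
  thus "norm ((orth_proj T - orth_proj S) *v x) \<le> 1 * norm x"
    by (simp add: p_def q_def matrix_vector_mult_diff_rdistrib)
qed simp

lemma sin_largest_principal_angle:
  fixes S T :: "(real^'m) set"
  assumes "subspace S" "subspace T"
  shows "largest_principal_angle S T \<in> {0..pi / 2}"
    and "sin (largest_principal_angle S T) = spectral_norm (orth_proj T - orth_proj S)"
proof -
  let ?d = "spectral_norm (orth_proj T - orth_proj S)"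
  have d: "0 \<le> ?d" "?d \<le> 1"
    using spectral_norm_orth_proj_diff_le_1[OF assms]
    by (auto simp: spectral_norm_def onorm_pos_le matrix_vector_mul_bounded_linear)
  have "\<exists>!\<theta>. 0 \<le> \<theta> \<and> \<theta> \<le> pi / 2 \<and> sin \<theta> = ?d"
  proof (rule ex1I[of _ "arcsin ?d"])
    show "0 \<le> arcsin ?d \<and> arcsin ?d \<le> pi / 2 \<and> sin (arcsin ?d) = ?d"
      using d arcsin_le_arcsin[of 0 ?d] arcsin_bounded[of ?d] by auto
    show "\<theta> = arcsin ?d" if "0 \<le> \<theta> \<and> \<theta> \<le> pi / 2 \<and> sin \<theta> = ?d" for \<theta>
      using that arcsin_sin[of \<theta>] by (metis order_trans pi_half_ge_zero neg_le_0_iff_le)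
  qed
  from theI'[OF this] show "largest_principal_angle S T \<in> {0..pi / 2}"
    and "sin (largest_principal_angle S T) = ?d"
    by (auto simp: largest_principal_angle_def)
qed

end

theory Submission
  imports Defs
begin

text \<open>
  With \<open>D\<^sub>j = z\<^sub>j z\<^sub>j\<^sup>T - E\<close> and \<open>Y\<^sub>j = \<tau> (D\<^sub>1 + \<dots> + D\<^sub>j)\<close>, consider \<open>\<Phi>(Y) = tr (exp Y - 1 - Y)\<close>.
  The Golden-Thompson inequality and \<open>exp X \<le> 1 + X + X\<^sup>2\<close> for small \<open>X\<close>, together with
  \<open>D\<^sub>j\<^sup>2 \<le> L\<^sup>2 E + (terms of mean zero)\<close> and \<open>tr (exp Y E) \<le> \<parallel>E\<parallel> \<Phi>(Y) + tr E + tr (Y E)\<close>, give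
  the recursion \<open>\<Phi>\<^sub>j\<^sub>+\<^sub>1 \<le> (1 + a) \<Phi>\<^sub>j + a intdim E\<close> in expectation, where \<open>a = \<tau>\<^sup>2 L\<^sup>2 \<parallel>E\<parallel>\<close>. Since all
  summands have the same second moment, nothing is lost by using Golden-Thompson instead of Lieb's
  theorem. Markov's inequality for \<open>\<tau> = \<plusminus>\<epsilon> / L\<^sup>2\<close> bounds the deviation of the sample moment by
  \<open>2 \<epsilon> \<parallel>E\<parallel>\<close>, which is less than half the eigenvalue gap, and the Weyl and Davis-Kahan perturbation
  bounds turn this into the claim. The target \<open>2 \<epsilon>\<close> in place of \<open>\<epsilon>\<close> leaves room for crude constants.
\<close>

section \<open>Endomorphisms as a Banach algebra\<close>

text \<open>Eigensystems are given for \<open>E\<close> and for the sample moment, but none for the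
  random matrices \<open>Y\<close>. Order relations between exponentials are therefore read off the
  scalar functions x . exp(t A) x by Taylor's formula, and traces are handled through cyclicity and
  square roots exp(A/2). Constants: put u = n a = n \<epsilon>^2 |E| / L^2. The recursion gives a
  mean potential of at most intdim(E) e^u. A unit vector at which the quadratic form of
  \<open>Y\<close> exceeds 2u forces the potential above e^(2u) - 1 - 2u, which is at least
  e^(2u)/2. Markov leaves 2 intdim(E) e^(-u) for each sign of \<tau>, hence 4 intdim(E) e^(-u) in
  total: this is the 4 inside the logarithm. As |\<tau>| L^2 = \<epsilon>, the level 2u corresponds
  to a deviation of 2 \<epsilon> |E|. The perturbation bound multiplies this by 2/gap, which yields
  the factor 4 |E| / gap. The quadratic bound on the exponential needs |\<tau> D| at most 1/2, that
  is \<epsilon> at most 1/4; this holds because the gap never exceeds |E|.\<close>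

text \<open>
  The library product on \<^typ>\<open>real^'m^'m\<close> is componentwise. A copy of the bounded endomorphisms with
  composition as product is a Banach algebra, so the library exponential applies to it.
\<close>

typedef (overloaded) ('a::euclidean_space) endo = "UNIV :: ('a \<Rightarrow>\<^sub>L 'a) set"
  by simp

setup_lifting type_definition_endo

instantiation endo :: (euclidean_space) real_vector
begin
lift_definition zero_endo :: "'a endo" is 0 .
lift_definition plus_endo :: "'a endo \<Rightarrow> 'a endo \<Rightarrow> 'a endo" is "(+)" .
lift_definition minus_endo :: "'a endo \<Rightarrow> 'a endo \<Rightarrow> 'a endo" is "(-)" .
lift_definition uminus_endo :: "'a endo \<Rightarrow> 'a endo" is uminus .
lift_definition scaleR_endo :: "real \<Rightarrow> 'a endo \<Rightarrow> 'a endo" is scaleR .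
instance by standard (transfer; simp add: algebra_simps)+
end

instantiation endo :: (euclidean_space) real_normed_vector
begin
lift_definition norm_endo :: "'a endo \<Rightarrow> real" is norm .
definition sgn_endo :: "'a endo \<Rightarrow> 'a endo" where "sgn_endo A = A /\<^sub>R norm A"
definition dist_endo :: "'a endo \<Rightarrow> 'a endo \<Rightarrow> real" where "dist_endo A B = norm (A - B)"
definition uniformity_endo :: "('a endo \<times> 'a endo) filter" where
  "uniformity_endo = (INF e\<in>{0<..}. principal {(A, B). dist A B < e})"
definition open_endo :: "'a endo set \<Rightarrow> bool" where
  "open_endo U = (\<forall>A\<in>U. eventually (\<lambda>(A', B). A' = A \<longrightarrow> B \<in> U) uniformity)"
instance
proof
  show "norm (A + B) \<le> norm A + norm B" for A B :: "'a endo"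
    by transfer (rule norm_triangle_ineq)
  show "norm A = 0 \<longleftrightarrow> A = 0" for A :: "'a endo"
    by transfer simp
  show "norm (r *\<^sub>R A) = \<bar>r\<bar> * norm A" for r and A :: "'a endo"
    by transfer simp
qed (simp_all add: sgn_endo_def dist_endo_def uniformity_endo_def open_endo_def)
end

instantiation endo :: (euclidean_space) real_normed_algebra_1
begin
lift_definition one_endo :: "'a endo" is id_blinfun .
lift_definition times_endo :: "'a endo \<Rightarrow> 'a endo \<Rightarrow> 'a endo" is blinfun_compose .
instance
proof
  fix A B C :: "'a endo" and r :: real
  show "A * B * C = A * (B * C)" "(A + B) * C = A * C + B * C" "A * (B + C) = A * B + A * C"
    "r *\<^sub>R A * B = r *\<^sub>R (A * B)" "A * r *\<^sub>R B = r *\<^sub>R (A * B)" "1 * A = A" "A * 1 = A"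
    by (transfer, rule blinfun_eqI, simp add: blinfun.bilinear_simps)+
  show "norm (A * B) \<le> norm A * norm B"
    by transfer (rule norm_blinfun_compose)
  show n1: "norm (1 :: 'a endo) = 1"
    by transfer simp
  show "(0 :: 'a endo) \<noteq> 1"
    using n1 by (metis norm_zero zero_neq_one)
qed
end

instance endo :: (euclidean_space) banach
proof
  fix X :: "nat \<Rightarrow> 'a endo"
  assume X: "Cauchy X"
  have "Cauchy (\<lambda>n. Rep_endo (X n))"
    using X unfolding Cauchy_def dist_norm by (simp add: norm_endo.rep_eq minus_endo.rep_eq)
  then obtain l where "(\<lambda>n. Rep_endo (X n)) \<longlonglongrightarrow> l"
    using Cauchy_convergent convergent_def by blast
  hence "X \<longlonglongrightarrow> Abs_endo l"
    unfolding tendsto_iff dist_norm by (simp add: norm_endo.rep_eq minus_endo.rep_eq Abs_endo_inverse)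
  thus "convergent X"
    by (auto simp: convergent_def)
qed

lift_definition app :: "'a::euclidean_space endo \<Rightarrow> 'a \<Rightarrow> 'a" is blinfun_apply .

definition endo_of :: "('a::euclidean_space \<Rightarrow> 'a) \<Rightarrow> 'a endo" where
  "endo_of f = Abs_endo (Blinfun f)"

lemma app_endo_of: "linear f \<Longrightarrow> app (endo_of f) = f"
  unfolding endo_of_def app.rep_eq
  by (simp add: Abs_endo_inverse bounded_linear_Blinfun_apply linear_conv_bounded_linear)

lemma endo_eqI: "(\<And>x. app A x = app B x) \<Longrightarrow> A = B"
  by transfer (rule blinfun_eqI)

lemma app_simps [simp]:
  "app 0 x = 0" "app 1 x = x" "app (A + B) x = app A x + app B x" "app (A - B) x = app A x - app B x"
  "app (- A) x = - app A x" "app (r *\<^sub>R A) x = r *\<^sub>R app A x" "app (A * B) x = app A (app B x)"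
  by (transfer; simp add: blinfun.bilinear_simps)+

lemma linear_app: "linear (app A)"
  by transfer (rule bounded_linear.linear[OF blinfun.bounded_linear_right])

lemmas app_linear_simps =
  linear_add[OF linear_app] linear_diff[OF linear_app] linear_scale[OF linear_app]
  linear_sum[OF linear_app] linear_0[OF linear_app] linear_neg[OF linear_app]

lemma norm_app: "norm (app A x) \<le> norm A * norm x"
  by transfer (rule norm_blinfun)

lemma norm_endo_bound: "0 \<le> b \<Longrightarrow> (\<And>x. norm (app A x) \<le> b * norm x) \<Longrightarrow> norm A \<le> b"
  by transfer (rule norm_blinfun_bound)

lemma bounded_linear_app_left: "bounded_linear (\<lambda>A. app A x)"
  by (rule bounded_linear_intro[where K = "norm x"]) (simp_all add: norm_app)

section \<open>Adjoints\<close>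

definition adj :: "'a::euclidean_space endo \<Rightarrow> 'a endo" where
  "adj A = endo_of (adjoint (app A))"

lemma adj_inner: "x \<bullet> app (adj A) y = app A x \<bullet> y"
  by (simp add: adj_def app_endo_of adjoint_linear linear_app adjoint_works)

lemma adj_inner_left: "app (adj A) x \<bullet> y = x \<bullet> app A y"
  by (metis adj_inner inner_commute)

lemma adj_unique:
  assumes "\<And>x y. x \<bullet> app B y = app A x \<bullet> y"
  shows "adj A = B"
proof (rule endo_eqI)
  fix y
  have "x \<bullet> app (adj A) y = x \<bullet> app B y" for x by (simp add: adj_inner assms)
  thus "app (adj A) y = app B y" using vector_eq_ldot by blast
qed

lemma adj_simps [simp]:
  "adj (adj A) = A" "adj 0 = 0" "adj 1 = 1" "adj (A + B) = adj A + adj B" "adj (A - B) = adj A - adj B"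
  "adj (- A) = - adj A" "adj (r *\<^sub>R A) = r *\<^sub>R adj A" "adj (A * B) = adj B * adj A"
  by (rule adj_unique, simp add: adj_inner adj_inner_left inner_simps)+

lemma adj_power [simp]: "adj (A ^ n) = adj A ^ n"
  by (induction n) (simp_all add: power_commutes)

text \<open>This makes \<open>adj\<close> continuous, so that it passes through the exponential
  series term by term.\<close>

lemma norm_adj_le: "norm (adj A) \<le> norm A"
proof (rule norm_endo_bound)
  fix x
  have "(norm (app (adj A) x))\<^sup>2 = app A (app (adj A) x) \<bullet> x"
    by (simp only: power2_norm_eq_inner adj_inner)
  also have "\<dots> \<le> norm (app A (app (adj A) x)) * norm x"
    by (rule norm_cauchy_schwarz)
  also have "\<dots> \<le> norm A * norm (app (adj A) x) * norm x"
    by (intro mult_right_mono norm_app) simp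
  finally show "norm (app (adj A) x) \<le> norm A * norm x"
    by (cases "app (adj A) x = 0") (simp_all add: power2_eq_square)
qed simp

lemma bounded_linear_adj: "bounded_linear adj"
  by (rule bounded_linear_intro[where K = 1]) (simp_all add: norm_adj_le)

lemma adj_exp: "adj (exp A) = exp (adj A)"
proof -
  have "adj (exp A) = (\<Sum>n. adj (A ^ n /\<^sub>R fact n))"
    unfolding exp_def by (rule bounded_linear.suminf[OF bounded_linear_adj summable_exp_generic])
  thus ?thesis by (simp add: exp_def)
qed

section \<open>Trace, cyclicity and Hilbert-Schmidt inequalities\<close>

definition tr :: "'a::euclidean_space endo \<Rightarrow> real" where
  "tr A = (\<Sum>b\<in>Basis. b \<bullet> app A b)"

lemma tr_simps [simp]:
  "tr 0 = 0" "tr (A + B) = tr A + tr B" "tr (A - B) = tr A - tr B" "tr (- A) = - tr A"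
  "tr (r *\<^sub>R A) = r * tr A"
  by (simp_all add: tr_def inner_simps sum.distrib sum_subtractf sum_negf sum_distrib_left)

lemma tr_commute: "tr (A * B) = tr (B * A)"
proof -
  have *: "tr (C * D) = (\<Sum>b\<in>Basis. \<Sum>c\<in>Basis. (b \<bullet> app C c) * (c \<bullet> app D b))" for C D :: "'a endo"
  proof -
    have "b \<bullet> app (C * D) b = (\<Sum>c\<in>Basis. (b \<bullet> app C c) * (c \<bullet> app D b))" for b
    proof -
      have "b \<bullet> app (C * D) b = app (adj C) b \<bullet> app D b"
        by (simp add: adj_inner_left)
      also have "\<dots> = (\<Sum>c\<in>Basis. (app (adj C) b \<bullet> c) * (app D b \<bullet> c))"
        by (rule euclidean_inner)
      finally show ?thesis
        by (simp add: adj_inner_left inner_commute[of "app D b"])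
    qed
    thus ?thesis by (simp add: tr_def)
  qed
  show ?thesis unfolding * by (subst sum.swap) (simp add: mult.commute)
qed

lemma tr_adj: "tr (adj A) = tr A"
  by (simp add: tr_def adj_inner inner_commute)

lemma bounded_linear_tr: "bounded_linear tr"
  unfolding tr_def
  by (intro bounded_linear_sum bounded_linear_compose[OF bounded_linear_inner_right bounded_linear_app_left])

lemma tr_mult_adj_nonneg: "0 \<le> tr (adj A * A)"
  by (simp add: tr_def adj_inner sum_nonneg)

text \<open>The squared Hilbert-Schmidt norm of \<open>A - adj A\<close> is nonnegative. This is the
  base case of the induction behind Golden-Thompson.\<close>

lemma tr_square_le: "tr (A * A) \<le> tr (A * adj A)"
proof -
  have "tr (adj (A - adj A) * (A - adj A)) = 2 * tr (A * adj A) - tr (A * A) - tr (adj (A * A))"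
    by (simp add: algebra_simps tr_commute[of "adj A" A])
  thus ?thesis using tr_mult_adj_nonneg[of "A - adj A"] by (simp only: tr_adj)
qed

lemma tr_mult_le:
  assumes "adj C = C" "adj D = D"
  shows "tr (C * D) \<le> (tr (C * C) + tr (D * D)) / 2"
  using tr_mult_adj_nonneg[of "C - D"] assms by (simp add: algebra_simps tr_commute[of D C])

lemma power_mult_rotate: "((A::'a::monoid_mult) * B) ^ n * A = A * (B * A) ^ n"
  by (induction n) (simp_all add: mult.assoc)

lemma tr_power_rotate: "0 < n \<Longrightarrow> tr ((A * B) ^ n) = tr ((B * A) ^ n)"
proof -
  assume "0 < n"
  then obtain m where n: "n = Suc m" by (cases n) auto
  have "tr ((A * B) ^ n) = tr (((A * B) ^ m * A) * B)" by (simp add: n power_Suc2 mult.assoc del: power_Suc)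
  also have "\<dots> = tr (B * (A * (B * A) ^ m))" by (simp add: power_mult_rotate tr_commute)
  finally show ?thesis by (simp add: n mult.assoc)
qed

section \<open>The Golden-Thompson inequality\<close>

text \<open>
  The two inequalities are proved by one induction: each instance of one is reduced to the other at
  the previous exponent.
\<close>

lemma tr_power_le:
  fixes A C D :: "'a::euclidean_space endo"
  shows "tr (A ^ (2 * 2 ^ j)) \<le> tr ((A * adj A) ^ 2 ^ j)"
    and "adj C = C \<Longrightarrow> adj D = D \<Longrightarrow> tr ((C * D) ^ 2 ^ j) \<le> tr (C ^ 2 ^ j * D ^ 2 ^ j)"
proof -
  have "(\<forall>A :: 'a endo. tr (A ^ (2 * 2 ^ j)) \<le> tr ((A * adj A) ^ 2 ^ j)) \<and>
    (\<forall>C D :: 'a endo. adj C = C \<longrightarrow> adj D = D \<longrightarrow> tr ((C * D) ^ 2 ^ j) \<le> tr (C ^ 2 ^ j * D ^ 2 ^ j))"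
  proof (induction j)
    case 0
    show ?case by (simp add: tr_square_le power2_eq_square)
  next
    case (Suc j)
    let ?q = "2 ^ j :: nat"
    have 1: "tr (A ^ (2 * 2 ^ Suc j)) \<le> tr ((A * adj A) ^ 2 ^ Suc j)" for A :: "'a endo"
    proof -
      let ?C = "adj A * A" and ?D = "A * adj A"
      have "tr (A ^ (2 * 2 ^ Suc j)) = tr ((A * A) ^ (2 * ?q))"
        by (simp only: power2_eq_square[symmetric] power_mult[symmetric]) simp
      also have "\<dots> \<le> tr ((A * A * adj (A * A)) ^ ?q)"
        using Suc.IH by blast
      also have "A * A * adj (A * A) = A * (A * adj A * adj A)"
        by (simp add: mult.assoc)
      \<comment> \<open>Moving the leading \<open>A\<close> to the end of the cyclic word leaves a
        product of two self-adjoint factors, the form that the other inequality requires.\<close>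
      also have "tr (\<dots> ^ ?q) = tr ((?D * ?C) ^ ?q)"
        by (subst tr_power_rotate) (simp_all add: mult.assoc)
      also have "\<dots> \<le> tr (?D ^ ?q * ?C ^ ?q)"
        using Suc.IH by simp
      also have "\<dots> \<le> (tr (?D ^ ?q * ?D ^ ?q) + tr (?C ^ ?q * ?C ^ ?q)) / 2"
        by (rule tr_mult_le) simp_all
      also have "\<dots> = (tr (?D ^ (2 * ?q)) + tr (?C ^ (2 * ?q))) / 2"
        by (simp only: mult_2 power_add)
      also have "tr (?C ^ (2 * ?q)) = tr (?D ^ (2 * ?q))"
        by (rule tr_power_rotate) simp
      finally show ?thesis by simp
    qed
    have 2: "tr ((C * D) ^ 2 ^ Suc j) \<le> tr (C ^ 2 ^ Suc j * D ^ 2 ^ Suc j)"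
      if "adj C = C" "adj D = D" for C D :: "'a endo"
    proof -
      \<comment> \<open>The first inequality at \<open>C * D\<close> turns the word into C D D C;
        rotation then collects the squares, and the second inequality applies to
        \<open>C * C\<close> and \<open>D * D\<close>.\<close>
      have "tr ((C * D) ^ (2 * ?q)) \<le> tr ((C * D * adj (C * D)) ^ ?q)"
        using Suc.IH by blast
      also have "C * D * adj (C * D) = C * (D * D * C)"
        using that by (simp add: mult.assoc)
      also have "tr (\<dots> ^ ?q) = tr ((D * D * (C * C)) ^ ?q)"
        by (subst tr_power_rotate) (simp_all add: mult.assoc)
      also have "\<dots> = tr ((C * C * (D * D)) ^ ?q)"
        by (rule tr_power_rotate) simp
      also have "\<dots> \<le> tr ((C * C) ^ ?q * (D * D) ^ ?q)"
        using Suc.IH that by simp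
      finally show ?thesis by (simp add: power_mult power2_eq_square)
    qed
    show ?case using 1 2 by blast
  qed
  thus "tr (A ^ (2 * 2 ^ j)) \<le> tr ((A * adj A) ^ 2 ^ j)"
    and "adj C = C \<Longrightarrow> adj D = D \<Longrightarrow> tr ((C * D) ^ 2 ^ j) \<le> tr (C ^ 2 ^ j * D ^ 2 ^ j)"
    by auto
qed

text \<open>Telescoping, one factor replaced at a time; \<open>1 \<le> c\<close> allows the exponent
  n - 1 to be rounded up to n.\<close>

lemma norm_power_diff_le:
  fixes S T :: "'a::real_normed_algebra_1"
  assumes "norm S \<le> c" "norm T \<le> c" "1 \<le> c"
  shows "norm (T ^ n - S ^ n) \<le> real n * c ^ n * norm (T - S)"
proof (induction n)
  case (Suc n)
  have "T ^ Suc n - S ^ Suc n = T * (T ^ n - S ^ n) + (T - S) * S ^ n"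
    by (simp add: algebra_simps)
  also have "norm \<dots> \<le> norm T * norm (T ^ n - S ^ n) + norm (T - S) * norm (S ^ n)"
    by (rule order_trans[OF norm_triangle_ineq]) (intro add_mono norm_mult_ineq)
  also have "\<dots> \<le> c * (real n * c ^ n * norm (T - S)) + norm (T - S) * c ^ n"
    using assms order_trans[OF norm_power_ineq power_mono[of "norm S" c n]]
    by (intro add_mono mult_mono Suc.IH) auto
  also have "\<dots> \<le> c * (real n * c ^ n * norm (T - S)) + norm (T - S) * (c * c ^ n)"
    using assms by (intro add_left_mono mult_left_mono) auto
  also have "\<dots> = real (Suc n) * c ^ Suc n * norm (T - S)"
    by (simp add: algebra_simps)
  finally show ?case .
qed simp

lemma exp_power_scaleR: "exp A ^ n = exp (real n *\<^sub>R A)"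
  for A :: "'a::{real_normed_algebra_1,banach}"
proof (induction n)
  case (Suc n)
  have "exp (A + real n *\<^sub>R A) = exp A * exp (real n *\<^sub>R A)"
    by (rule exp_add_commuting) simp
  with Suc show ?case by (simp add: algebra_simps)
qed simp

text \<open>\<open>T\<close> and \<open>S\<close> agree to first order at 0, so their difference at
  t = 1/n is o(1/n). Passing to n-th powers costs a factor n and the power \<open>c ^ n\<close>,
  which equals the constant \<open>K\<close>.\<close>

lemma lie_product_formula:
  fixes A B :: "'a::{real_normed_algebra_1,banach}"
  shows "(\<lambda>n. (exp (inverse (real n) *\<^sub>R A) * exp (inverse (real n) *\<^sub>R B)) ^ n) \<longlonglongrightarrow> exp (A + B)"
proof -
  define S where "S t = exp (t *\<^sub>R (A + B))" for t :: real
  define T where "T t = exp (t *\<^sub>R A) * exp (t *\<^sub>R B)" for t :: real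
  define K where "K = exp (norm A + norm B)"
  have "((\<lambda>t. T t - S t) has_vector_derivative
      (exp (0 *\<^sub>R A) * (B * exp (0 *\<^sub>R B)) + A * exp (0 *\<^sub>R A) * exp (0 *\<^sub>R B)) - (A + B) * exp (0 *\<^sub>R (A + B))) (at 0)"
    unfolding S_def T_def
    by (intro has_vector_derivative_diff has_vector_derivative_mult exp_scaleR_has_vector_derivative_left)
  hence "((\<lambda>t. T t - S t) has_vector_derivative 0) (at 0)"
    by (simp add: add.commute)
  hence "((\<lambda>t. norm (T t - S t) / \<bar>t\<bar>) \<longlongrightarrow> 0) (at 0)"
    by (simp add: has_vector_derivative_def has_derivative_at S_def T_def)
  moreover have "filterlim (\<lambda>n. inverse (real n)) (at 0) sequentially"
    unfolding filterlim_at
    by (auto intro!: lim_inverse_n eventually_sequentiallyI[of 1])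
  ultimately have "(\<lambda>n. norm (T (inverse (real n)) - S (inverse (real n))) / \<bar>inverse (real n)\<bar>) \<longlonglongrightarrow> 0"
    by (rule filterlim_compose)
  hence lim: "(\<lambda>n. K * (norm (T (inverse (real n)) - S (inverse (real n))) / \<bar>inverse (real n)\<bar>)) \<longlonglongrightarrow> 0"
    by (rule tendsto_mult_right_zero)
  have "(\<lambda>n. T (inverse (real n)) ^ n - S (inverse (real n)) ^ n) \<longlonglongrightarrow> 0"
  proof (rule Lim_null_comparison[OF _ lim], rule eventually_sequentiallyI[of 1])
    fix n :: nat assume n: "1 \<le> n"
    define t where "t = inverse (real n)"
    define c where "c = exp (t * (norm A + norm B))"
    have t: "0 < t" "real n * t = 1" using n by (simp_all add: t_def)
    have "norm (S t) \<le> exp (norm (t *\<^sub>R (A + B)))"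
      unfolding S_def by (rule norm_exp)
    also have "\<dots> \<le> c"
      using t norm_triangle_ineq[of A B] by (simp add: c_def)
    finally have S: "norm (S t) \<le> c" .
    have "norm (T t) \<le> exp (norm (t *\<^sub>R A)) * exp (norm (t *\<^sub>R B))"
      unfolding T_def by (rule order_trans[OF norm_mult_ineq]) (intro mult_mono norm_exp; simp)
    also have "\<dots> = c"
      using t by (simp add: c_def exp_add[symmetric] algebra_simps)
    finally have T: "norm (T t) \<le> c" .
    have "norm (T t ^ n - S t ^ n) \<le> real n * c ^ n * norm (T t - S t)"
      by (rule norm_power_diff_le[OF S T]) (use t in \<open>simp add: c_def\<close>)
    also have "c ^ n = K"
      unfolding c_def K_def exp_power_scaleR using t by (simp add: mult.assoc[symmetric])
    also have "real n * K * norm (T t - S t) = K * (norm (T t - S t) / \<bar>t\<bar>)"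
      using t by (simp add: field_simps)
    finally show "norm (T (inverse (real n)) ^ n - S (inverse (real n)) ^ n)
        \<le> K * (norm (T (inverse (real n)) - S (inverse (real n))) / \<bar>inverse (real n)\<bar>)"
      by (simp add: t_def)
  qed
  moreover have "(\<lambda>n. S (inverse (real n)) ^ n) \<longlonglongrightarrow> exp (A + B)"
  proof (rule tendsto_eventually, rule eventually_sequentiallyI[of 1])
    fix n :: nat assume "1 \<le> n"
    thus "S (inverse (real n)) ^ n = exp (A + B)"
      unfolding S_def exp_power_scaleR by simp
  qed
  ultimately have "(\<lambda>n. T (inverse (real n)) ^ n - S (inverse (real n)) ^ n + S (inverse (real n)) ^ n)
      \<longlonglongrightarrow> 0 + exp (A + B)"
    by (rule tendsto_add)
  thus ?thesis by (simp add: T_def)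
qed

theorem golden_thompson:
  assumes A: "adj A = A" and B: "adj B = B"
  shows "tr (exp (A + B)) \<le> tr (exp A * exp B)"
proof -
  define f where "f n = tr ((exp (inverse (real n) *\<^sub>R A) * exp (inverse (real n) *\<^sub>R B)) ^ n)" for n
  have "f \<longlonglongrightarrow> tr (exp (A + B))"
    unfolding f_def by (intro bounded_linear.tendsto[OF bounded_linear_tr] lie_product_formula)
  \<comment> \<open>The trace inequality is available at powers of two, which suffices because the
    Lie limit may be taken along a subsequence.\<close>
  hence "(f \<circ> (\<lambda>j. 2 ^ j)) \<longlonglongrightarrow> tr (exp (A + B))"
    by (rule LIMSEQ_subseq_LIMSEQ) (simp add: strict_mono_def)
  moreover have "f (2 ^ j) \<le> tr (exp A * exp B)" for j
  proof -
    let ?A = "exp (inverse (real (2 ^ j)) *\<^sub>R A)" and ?B = "exp (inverse (real (2 ^ j)) *\<^sub>R B)"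
    have "f (2 ^ j) \<le> tr (?A ^ 2 ^ j * ?B ^ 2 ^ j)"
      unfolding f_def by (rule tr_power_le(2)) (simp_all add: adj_exp A B)
    thus ?thesis unfolding exp_power_scaleR by simp
  qed
  ultimately show ?thesis
    by (intro LIMSEQ_le_const2) auto
qed

section \<open>Quadratic forms of the exponential\<close>

lemma exp_quadratic_form_nonneg:
  assumes "adj A = A"
  shows "0 \<le> x \<bullet> app (exp A) x"
proof -
  have "exp A = exp ((1/2) *\<^sub>R A) ^ 2"
    unfolding exp_power_scaleR by simp
  hence "x \<bullet> app (exp A) x = app (exp ((1/2) *\<^sub>R A)) x \<bullet> app (exp ((1/2) *\<^sub>R A)) x"
    using adj_inner[of x "exp ((1/2) *\<^sub>R A)"] assms
    by (simp add: power2_eq_square adj_exp)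
  thus ?thesis by simp
qed

text \<open>Since \<open>exp A\<close> is the square of the self-adjoint \<open>?R\<close>,
  cyclicity writes the trace as a sum of quadratic forms at the vectors \<open>app ?R b\<close>. An
  operator inequality can thus be inserted next to \<open>exp A\<close> under the trace.\<close>

lemma tr_exp_mult_mono:
  assumes A: "adj A = A" and le: "\<And>x. x \<bullet> app F x \<le> x \<bullet> app G x"
  shows "tr (exp A * F) \<le> tr (exp A * G)"
proof -
  let ?R = "exp ((1/2) *\<^sub>R A)"
  have e: "exp A = ?R * ?R"
    using exp_power_scaleR[of "(1/2) *\<^sub>R A" 2] by (simp add: power2_eq_square)
  have R: "adj ?R = ?R" using A by (simp add: adj_exp)
  have *: "tr (exp A * H) = (\<Sum>b\<in>Basis. app ?R b \<bullet> app H (app ?R b))" for H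
  proof -
    have "tr (exp A * H) = tr (?R * H * ?R)"
      unfolding e by (simp add: mult.assoc tr_commute[of ?R "?R * H"])
    also have "\<dots> = (\<Sum>b\<in>Basis. b \<bullet> app (adj ?R) (app H (app ?R b)))"
      unfolding R by (simp add: tr_def)
    finally show ?thesis by (simp add: adj_inner)
  qed
  show ?thesis unfolding * by (intro sum_mono le)
qed

text \<open>Maclaurin's formula of order two for the scalar function x . exp(t A) x. As
  \<open>A\<close> commutes with its exponential, one factor \<open>A\<close> moves to each side of
  the remainder, which becomes a quadratic form at \<open>app A x\<close>.\<close>

lemma exp_quadratic_form_Taylor:
  assumes A: "adj A = A"
  shows "\<exists>s\<in>{0<..<1}. x \<bullet> app (exp A) x =
           x \<bullet> x + x \<bullet> app A x + (app A x \<bullet> app (exp (s *\<^sub>R A)) (app A x)) / 2"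
proof -
  define d where "d m t = x \<bullet> app (A ^ m * exp (t *\<^sub>R A)) x" for m t
  have d: "DERIV (d m) t :> d (Suc m) t" for m t
  proof -
    have "bounded_linear (\<lambda>F. x \<bullet> app (A ^ m * F) x)"
      by (intro bounded_linear_compose[OF bounded_linear_inner_right]
          bounded_linear_compose[OF bounded_linear_app_left] bounded_linear_mult_right)
    from bounded_linear.has_vector_derivative[OF this exp_scaleR_has_vector_derivative_left[of A t]]
    moreover have "d m = (\<lambda>t. x \<bullet> app (A ^ m * exp (t *\<^sub>R A)) x)"
      by (simp add: fun_eq_iff d_def)
    moreover have "A ^ m * (A * exp (t *\<^sub>R A)) = A ^ Suc m * exp (t *\<^sub>R A)"
      by (simp add: power_Suc2 mult.assoc del: power_Suc)
    ultimately show ?thesis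
      by (simp add: d_def has_real_derivative_iff_has_vector_derivative)
  qed
  obtain s where s: "0 < s" "s < 1" "d 0 1 = (\<Sum>m<2. d m 0 / fact m * 1 ^ m) + d 2 s / fact 2 * 1 ^ 2"
    using Maclaurin[of 1 2 d "d 0"] d by auto
  have "d 2 s = x \<bullet> app (A * exp (s *\<^sub>R A) * A) x"
    by (simp add: d_def power2_eq_square mult.assoc exp_times_scaleR_commute del: app_simps)
  also have "\<dots> = app A x \<bullet> app (exp (s *\<^sub>R A)) (app A x)"
    using adj_inner[of x A] A by simp
  finally have d2: "d 2 s = app A x \<bullet> app (exp (s *\<^sub>R A)) (app A x)" .
  show ?thesis
    using s(1,2) s(3)[unfolded d2] by (intro bexI[of _ s]) (simp_all add: d_def numeral_2_eq_2)
qed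

lemma exp_quadratic_form_ge:
  assumes "adj A = A"
  shows "x \<bullet> x + x \<bullet> app A x \<le> x \<bullet> app (exp A) x"
proof -
  obtain s where "x \<bullet> app (exp A) x =
      x \<bullet> x + x \<bullet> app A x + (app A x \<bullet> app (exp (s *\<^sub>R A)) (app A x)) / 2"
    using exp_quadratic_form_Taylor[OF assms] by blast
  moreover have "0 \<le> app A x \<bullet> app (exp (s *\<^sub>R A)) (app A x)"
    using assms by (intro exp_quadratic_form_nonneg) simp
  ultimately show ?thesis by simp
qed

lemma exp_quadratic_form_le:
  assumes A: "adj A = A" and n: "norm A \<le> 1 / 2"
  shows "x \<bullet> app (exp A) x \<le> x \<bullet> x + x \<bullet> app A x + app A x \<bullet> app A x"
proof -
  obtain s where s: "0 < s" "s < 1" and eq: "x \<bullet> app (exp A) x =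
      x \<bullet> x + x \<bullet> app A x + (app A x \<bullet> app (exp (s *\<^sub>R A)) (app A x)) / 2"
    using exp_quadratic_form_Taylor[OF A, of x] by auto
  have "norm (s *\<^sub>R A) \<le> 1 / 2"
    using s n mult_mono[of s 1 "norm A" "1/2"] by simp
  \<comment> \<open>On [0, 1/2] the exponential is at most 1 + 2t. The bound 2 cancels the factor
    1/2 of the remainder.\<close>
  hence "exp (norm (s *\<^sub>R A)) \<le> 2"
    using real_exp_bound_lemma[of "norm (s *\<^sub>R A)"] by simp
  hence e: "norm (exp (s *\<^sub>R A)) \<le> 2"
    using norm_exp order_trans by blast
  have "app A x \<bullet> app (exp (s *\<^sub>R A)) (app A x) \<le> norm (app A x) * norm (app (exp (s *\<^sub>R A)) (app A x))"
    by (rule norm_cauchy_schwarz)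
  also have "\<dots> \<le> norm (app A x) * (2 * norm (app A x))"
    by (intro mult_left_mono order_trans[OF norm_app] mult_right_mono e) simp_all
  also have "\<dots> = 2 * (app A x \<bullet> app A x)"
    by (simp add: dot_square_norm power2_eq_square)
  finally show ?thesis unfolding eq by simp
qed

lemma tr_orthonormal_basis:
  fixes A :: "'a::euclidean_space endo"
  assumes S: "pairwise orthogonal S" "\<And>b. b \<in> S \<Longrightarrow> norm b = 1" "finite S" "span S = UNIV"
  shows "tr A = (\<Sum>b\<in>S. b \<bullet> app A b)"
proof -
  have "c \<bullet> app A c = (\<Sum>b\<in>S. (c \<bullet> b) * (c \<bullet> app A b))" for c
  proof -
    have "app A c = app A (\<Sum>b\<in>S. (c \<bullet> b) *\<^sub>R b)"
      using orthonormal_basis_expand[OF S(1,2)] S(3,4) by simp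
    thus ?thesis by (simp add: app_linear_simps inner_sum_right)
  qed
  hence "tr A = (\<Sum>c\<in>Basis. \<Sum>b\<in>S. (c \<bullet> b) * (c \<bullet> app A b))"
    by (simp add: tr_def)
  also have "\<dots> = (\<Sum>b\<in>S. \<Sum>c\<in>Basis. (b \<bullet> c) * (app A b \<bullet> c))"
    by (subst sum.swap) (simp add: inner_commute)
  also have "\<dots> = (\<Sum>b\<in>S. b \<bullet> app A b)"
    by (simp add: euclidean_inner[symmetric])
  finally show ?thesis .
qed

text \<open>Extend \<open>x\<close> to an orthonormal basis; the other diagonal terms of the trace
  are nonnegative.\<close>

lemma quadratic_form_le_tr:
  fixes A :: "'a::euclidean_space endo"
  assumes "\<And>y. 0 \<le> y \<bullet> app A y" and "norm x = 1"
  shows "x \<bullet> app A x \<le> tr A"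
proof -
  obtain S where S: "x \<in> S" "pairwise orthogonal S" "\<And>x. x \<in> S \<Longrightarrow> norm x = 1" "independent S" "span S = UNIV"
    using vector_in_orthonormal_basis[OF \<open>norm x = 1\<close>] by metis
  have fin: "finite S" by (rule finiteI_independent) fact
  have "tr A = (\<Sum>b\<in>S. b \<bullet> app A b)"
    by (rule tr_orthonormal_basis) (use S fin in auto)
  also have "\<dots> \<ge> x \<bullet> app A x"
    by (rule member_le_sum) (use S assms fin in auto)
  finally show ?thesis .
qed

text \<open>Subtracting the scalar \<open>s\<close>, the value of the form at \<open>x\<close>,
  extracts a factor e^s and kills the first-order term at \<open>x\<close>, so the linear lower
  bound leaves exactly 1.\<close>

lemma exp_quadratic_form_Jensen:
  assumes A: "adj A = A" and x: "norm x = 1"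
  shows "exp (x \<bullet> app A x) \<le> x \<bullet> app (exp A) x"
proof -
  define s where "s = x \<bullet> app A x"
  have xx: "x \<bullet> x = 1" using x by (simp add: dot_square_norm)
  have "A = s *\<^sub>R 1 + (A - s *\<^sub>R 1)" by simp
  hence "exp A = exp (s *\<^sub>R 1) * exp (A - s *\<^sub>R 1)"
    by (metis exp_add_commuting mult_scaleR_left mult_scaleR_right mult_1_left mult_1_right)
  also have "exp (s *\<^sub>R 1 :: 'a endo) = exp s *\<^sub>R 1"
    using exp_of_real[of s, where 'a = "'a endo"] by (simp add: of_real_def)
  finally have "x \<bullet> app (exp A) x = exp s * (x \<bullet> app (exp (A - s *\<^sub>R 1)) x)" by simp
  moreover have "1 \<le> x \<bullet> app (exp (A - s *\<^sub>R 1)) x"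
    using exp_quadratic_form_ge[of "A - s *\<^sub>R 1" x] A by (simp add: inner_diff_right xx s_def)
  ultimately show ?thesis by (simp add: s_def)
qed

text \<open>
  Subtracting \<open>1 + A\<close> from the exponential is what makes the final bound depend on the intrinsic
  dimension: the usual potential \<open>tr (exp A)\<close> starts at the full dimension, this one at zero.
\<close>

definition exp_excess :: "'a::euclidean_space endo \<Rightarrow> real" where
  "exp_excess A = tr (exp A - 1 - A)"

text \<open>exp A - 1 - A is positive semi-definite, so its trace dominates every single Rayleigh
  quotient. This is how the potential controls extreme eigenvalues.\<close>

lemma exp_excess_ge:
  assumes A: "adj A = A" and x: "norm x = 1"
  shows "exp (x \<bullet> app A x) - 1 - x \<bullet> app A x \<le> exp_excess A"
proof -
  have "exp (x \<bullet> app A x) - 1 - x \<bullet> app A x \<le> x \<bullet> app (exp A - 1 - A) x"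
    using exp_quadratic_form_Jensen[OF assms] x by (simp add: inner_diff_right dot_square_norm)
  also have "\<dots> \<le> exp_excess A"
    unfolding exp_excess_def using exp_quadratic_form_ge[OF A]
    by (intro quadratic_form_le_tr x) (simp add: inner_diff_right algebra_simps)
  finally show ?thesis .
qed

section \<open>Perturbation of eigenvalues and dominant subspaces\<close>

lemma norm_mult_le_spectral_norm: "norm (A *v x) \<le> spectral_norm A * norm x"
  unfolding spectral_norm_def by (rule onorm) simp

lemma spectral_norm_le: "0 \<le> b \<Longrightarrow> (\<And>x. norm (A *v x) \<le> b * norm x) \<Longrightarrow> spectral_norm A \<le> b"
  unfolding spectral_norm_def by (rule onorm_bound)

lemma spectral_norm_nonneg: "0 \<le> spectral_norm A"
  unfolding spectral_norm_def by (rule onorm_pos_le) simp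

lemma spectral_norm_minus_commute: "spectral_norm (A - B) = spectral_norm (B - A)"
proof -
  have "(\<lambda>x. (B - A) *v x) = (\<lambda>x. - ((A - B) *v x))"
    by (simp add: fun_eq_iff matrix_vector_mult_diff_rdistrib)
  thus ?thesis unfolding spectral_norm_def by (simp only: onorm_neg)
qed

lemma quadratic_form_le_spectral_norm: "\<bar>x \<bullet> (A *v x)\<bar> \<le> spectral_norm A * (norm x)\<^sup>2"
proof -
  have "\<bar>x \<bullet> (A *v x)\<bar> \<le> norm x * norm (A *v x)"
    by (rule Cauchy_Schwarz_ineq2)
  also have "\<dots> \<le> norm x * (spectral_norm A * norm x)"
    by (intro mult_left_mono norm_mult_le_spectral_norm) simp
  finally show ?thesis by (simp add: power2_eq_square algebra_simps)
qed

section \<open>Projectors onto spans of orthonormal families\<close>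

definition orthonormal_on :: "'i set \<Rightarrow> ('i \<Rightarrow> 'b::real_inner) \<Rightarrow> bool" where
  "orthonormal_on I v \<longleftrightarrow> (\<forall>i\<in>I. \<forall>j\<in>I. v i \<bullet> v j = (if i = j then 1 else 0))"

text \<open>The orthogonal projector when \<open>v\<close> is orthonormal on \<open>J\<close>. The
  index set stays explicit so that complementary eigenspaces are simply \<open>J\<close> and
  \<open>I - J\<close>.\<close>

definition span_proj :: "('i \<Rightarrow> 'b::real_inner) \<Rightarrow> 'i set \<Rightarrow> 'b \<Rightarrow> 'b" where
  "span_proj v J x = (\<Sum>i\<in>J. (x \<bullet> v i) *\<^sub>R v i)"

lemma span_proj_selfadjoint: "span_proj v J x \<bullet> y = x \<bullet> span_proj v J y"
  by (simp add: span_proj_def inner_sum_left inner_sum_right inner_commute mult.commute)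

lemma span_proj_diff: "span_proj v J (x - y) = span_proj v J x - span_proj v J y"
  by (simp add: span_proj_def inner_diff_left scaleR_diff_left sum_subtractf)

lemma span_proj_add: "span_proj v J (x + y) = span_proj v J x + span_proj v J y"
  by (simp add: span_proj_def inner_add_left scaleR_add_left sum.distrib)

lemma span_proj_in_span: "span_proj v J x \<in> span (v ` J)"
  unfolding span_proj_def by (intro span_sum span_scale span_base imageI)

lemma linear_span_proj: "linear (span_proj v J)"
  by (rule linearI) (simp_all add: span_proj_add, simp add: span_proj_def scaleR_sum_right)

lemma orthonormal_sum_inner:
  assumes "orthonormal_on I v" "finite J" "J \<subseteq> I" "i \<in> I"
  shows "(\<Sum>j\<in>J. c j *\<^sub>R v j) \<bullet> v i = (if i \<in> J then c i else 0)"
proof -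
  have "(\<Sum>j\<in>J. c j *\<^sub>R v j) \<bullet> v i = (\<Sum>j\<in>J. if j = i then c i else 0)"
    unfolding inner_sum_left
    by (rule sum.cong) (use assms in \<open>auto simp: orthonormal_on_def\<close>)
  thus ?thesis using assms(2) by simp
qed

lemma orthonormal_norm_sum:
  assumes "orthonormal_on I v" "finite J" "J \<subseteq> I"
  shows "(norm (\<Sum>j\<in>J. c j *\<^sub>R v j))\<^sup>2 = (\<Sum>j\<in>J. (c j)\<^sup>2)"
proof -
  define s where "s = (\<Sum>j\<in>J. c j *\<^sub>R v j)"
  have "(norm s)\<^sup>2 = s \<bullet> (\<Sum>i\<in>J. c i *\<^sub>R v i)"
    by (simp add: power2_norm_eq_inner s_def)
  also have "\<dots> = (\<Sum>i\<in>J. c i * ((\<Sum>j\<in>J. c j *\<^sub>R v j) \<bullet> v i))"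
    unfolding inner_sum_right by (simp add: s_def)
  also have "\<dots> = (\<Sum>i\<in>J. (c i)\<^sup>2)"
  proof (rule sum.cong)
    show "c i * ((\<Sum>j\<in>J. c j *\<^sub>R v j) \<bullet> v i) = (c i)\<^sup>2" if "i \<in> J" for i
      using orthonormal_sum_inner[OF assms, of i c] that assms(3) by (auto simp: power2_eq_square)
  qed simp
  finally show ?thesis by (simp add: s_def)
qed

lemma span_proj_idem:
  assumes "orthonormal_on I v" "finite J" "J \<subseteq> I"
  shows "span_proj v J (span_proj v J x) = span_proj v J x"
proof -
  have "span_proj v J x \<bullet> v i = x \<bullet> v i" if "i \<in> J" for i
    using orthonormal_sum_inner[OF assms, of i "\<lambda>i. x \<bullet> v i"] that assms(3) by (auto simp: span_proj_def)
  thus ?thesis by (simp add: span_proj_def[of v J "span_proj v J x"]) (simp add: span_proj_def)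
qed

lemma orth_proj_span:
  fixes v :: "nat \<Rightarrow> real^'m"
  assumes "orthonormal_on I v" "finite J" "J \<subseteq> I"
  shows "orth_proj (span (v ` J)) *v x = span_proj v J x"
proof -
  let ?S = "span (v ` J)"
  have "orthogonal (x - span_proj v J x) w" if "w \<in> ?S" for w
  proof -
    have "orthogonal (x - span_proj v J x) (v i)" if "i \<in> J" for i
      using that assms orthonormal_sum_inner[of I v J i "\<lambda>i. x \<bullet> v i"]
      by (auto simp: orthogonal_def inner_diff_left span_proj_def)
    thus ?thesis by (intro orthogonal_to_span[OF that]) auto
  qed
  moreover have "\<exists>!y. y \<in> ?S \<and> (\<forall>w\<in>?S. orthogonal (x - y) w)"
    by (rule orth_proj_unique) simp
  ultimately show ?thesis
    using orth_proj_mult[of ?S] span_proj_in_span[of v J x] by auto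
qed

lemma eigensystem_orthonormal: "ordered_eigensystem (A :: real^'m^'m) l v \<Longrightarrow> orthonormal_on {1..CARD('m)} v"
  by (simp add: ordered_eigensystem_def orthonormal_on_def)

context
  fixes v :: "nat \<Rightarrow> real^'m" and I :: "nat set"
  assumes on: "orthonormal_on I v" and I: "finite I"
begin

lemma orthonormal_image: "inj_on v I" "pairwise orthogonal (v ` I)" "\<And>b. b \<in> v ` I \<Longrightarrow> norm b = 1"
proof -
  show inj: "inj_on v I"
    using on by (intro inj_onI) (metis orthonormal_on_def zero_neq_one)
  show "pairwise orthogonal (v ` I)"
    using on by (auto simp: pairwise_def orthogonal_def orthonormal_on_def)
  show "\<And>b. b \<in> v ` I \<Longrightarrow> norm b = 1"
    using on by (auto simp: norm_eq_1 orthonormal_on_def)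
qed

lemma dim_span_orthonormal:
  assumes J: "J \<subseteq> I"
  shows "dim (span (v ` J)) = card J"
proof -
  have "pairwise orthogonal (v ` J)"
    by (rule pairwise_subset[OF orthonormal_image(2)]) (use J in auto)
  moreover have "0 \<notin> v ` J"
    using orthonormal_image(3) J by fastforce
  ultimately have "independent (v ` J)" by (rule pairwise_orthogonal_independent)
  thus ?thesis
    using orthonormal_image(1) J by (simp add: dim_eq_card_independent card_image inj_on_subset)
qed

lemma span_proj_full:
  assumes c: "card I = CARD('m)"
  shows "span_proj v I x = x" "span (v ` I) = UNIV"
proof -
  show s: "span (v ` I) = UNIV"
    using dim_span_orthonormal[of I] c dim_eq_full[of "v ` I"] by (simp add: dim_span)
  have "(\<Sum>b\<in>v ` I. (x \<bullet> b) *\<^sub>R b) = x"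
    using orthonormal_image(2,3) I s by (intro orthonormal_basis_expand) auto
  thus "span_proj v I x = x"
    by (simp add: span_proj_def sum.reindex[OF orthonormal_image(1)])
qed

lemma norm_span_proj:
  assumes "J \<subseteq> I"
  shows "(norm (span_proj v J x))\<^sup>2 = (\<Sum>j\<in>J. (x \<bullet> v j)\<^sup>2)"
  unfolding span_proj_def by (rule orthonormal_norm_sum[OF on]) (use assms I finite_subset in auto)

lemma norm_span_proj_le:
  assumes c: "card I = CARD('m)" and J: "J \<subseteq> I"
  shows "norm (span_proj v J x) \<le> norm x"
proof -
  have "(norm (span_proj v J x))\<^sup>2 \<le> (norm (span_proj v I x))\<^sup>2"
    using J I by (simp add: norm_span_proj sum_mono2)
  thus ?thesis by (simp add: span_proj_full[OF c])
qed

lemma span_proj_compl: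
  assumes c: "card I = CARD('m)" and J: "J \<subseteq> I"
  shows "span_proj v (I - J) x = x - span_proj v J x"
  using span_proj_full(1)[OF c, of x] J I
  by (simp add: span_proj_def sum_diff)

end

text \<open>An orthonormal eigenbasis makes \<open>A\<close> self-adjoint; expanding
  \<open>x\<close> in that basis gives the identity directly.\<close>

lemma eigensystem_inner:
  fixes A :: "real^'m^'m"
  assumes es: "ordered_eigensystem A l v" and i: "i \<in> {1..CARD('m)}"
  shows "(A *v x) \<bullet> v i = l i * (x \<bullet> v i)"
proof -
  let ?I = "{1..CARD('m)}"
  note on = eigensystem_orthonormal[OF es]
  have "A *v x = A *v span_proj v ?I x"
    using span_proj_full(1)[OF on] by simp
  also have "\<dots> = (\<Sum>j\<in>?I. (x \<bullet> v j) *\<^sub>R (A *v v j))"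
    by (simp add: span_proj_def matrix_vector_mult_scaleR vec.sum matrix_vector_right_distrib
        linear_sum[OF matrix_vector_mul_linear])
  also have "\<dots> = (\<Sum>j\<in>?I. (l j * (x \<bullet> v j)) *\<^sub>R v j)"
    using es by (intro sum.cong) (auto simp: ordered_eigensystem_def)
  finally show ?thesis
    using orthonormal_sum_inner[OF on _ _ i, of ?I] i by simp
qed

lemma eigensystem_quadratic_form:
  fixes A :: "real^'m^'m"
  assumes es: "ordered_eigensystem A l v"
  shows "x \<bullet> (A *v x) = (\<Sum>i\<in>{1..CARD('m)}. l i * (x \<bullet> v i)\<^sup>2)"
proof -
  let ?I = "{1..CARD('m)}"
  have "x \<bullet> (A *v x) = span_proj v ?I x \<bullet> (A *v x)"
    using span_proj_full(1)[OF eigensystem_orthonormal[OF es]] by simp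
  also have "\<dots> = (\<Sum>i\<in>?I. (x \<bullet> v i) * (v i \<bullet> (A *v x)))"
    by (simp add: span_proj_def inner_sum_left)
  also have "\<dots> = (\<Sum>i\<in>?I. l i * (x \<bullet> v i)\<^sup>2)"
    by (rule sum.cong) (simp_all add: inner_commute[of "v _"] eigensystem_inner[OF es] power2_eq_square)
  finally show ?thesis .
qed

lemma span_orthonormal_inner_eq_0:
  assumes on: "orthonormal_on I v" and "J \<subseteq> I" "i \<in> I" "i \<notin> J" "x \<in> span (v ` J)"
  shows "x \<bullet> v i = 0"
proof -
  have "orthogonal (v i) x"
    by (rule orthogonal_to_span[OF assms(5)]) (use assms in \<open>auto simp: orthonormal_on_def orthogonal_def\<close>)
  thus ?thesis by (simp add: orthogonal_def inner_commute)
qed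

lemma eigensystem_norm_eq:
  fixes A :: "real^'m^'m"
  assumes "ordered_eigensystem A l v"
  shows "(norm x)\<^sup>2 = (\<Sum>i\<in>{1..CARD('m)}. (x \<bullet> v i)\<^sup>2)"
  using norm_span_proj[OF eigensystem_orthonormal[OF assms], of "{1..CARD('m)}" x]
    span_proj_full(1)[OF eigensystem_orthonormal[OF assms]] by simp

lemma eigensystem_quadratic_form_ge:
  fixes A :: "real^'m^'m"
  assumes es: "ordered_eigensystem A l v" and J: "J \<subseteq> {1..CARD('m)}"
    and x: "x \<in> span (v ` J)" and c: "\<And>i. i \<in> J \<Longrightarrow> c \<le> l i"
  shows "c * (norm x)\<^sup>2 \<le> x \<bullet> (A *v x)"
  unfolding eigensystem_quadratic_form[OF es] eigensystem_norm_eq[OF es] sum_distrib_left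
proof (rule sum_mono)
  fix i assume i: "i \<in> {1..CARD('m)}"
  show "c * (x \<bullet> v i)\<^sup>2 \<le> l i * (x \<bullet> v i)\<^sup>2"
    using c[of i] span_orthonormal_inner_eq_0[OF eigensystem_orthonormal[OF es] J i _ x]
    by (cases "i \<in> J") (auto intro: mult_right_mono)
qed

lemma eigensystem_quadratic_form_le:
  fixes A :: "real^'m^'m"
  assumes es: "ordered_eigensystem A l v" and J: "J \<subseteq> {1..CARD('m)}"
    and x: "x \<in> span (v ` J)" and c: "\<And>i. i \<in> J \<Longrightarrow> l i \<le> c"
  shows "x \<bullet> (A *v x) \<le> c * (norm x)\<^sup>2"
  unfolding eigensystem_quadratic_form[OF es] eigensystem_norm_eq[OF es] sum_distrib_left
proof (rule sum_mono)
  fix i assume i: "i \<in> {1..CARD('m)}"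
  show "l i * (x \<bullet> v i)\<^sup>2 \<le> c * (x \<bullet> v i)\<^sup>2"
    using c[of i] span_orthonormal_inner_eq_0[OF eigensystem_orthonormal[OF es] J i _ x]
    by (cases "i \<in> J") (auto intro: mult_right_mono)
qed

lemma eigensystem_decreasing:
  fixes A :: "real^'m^'m"
  shows "ordered_eigensystem A l v \<Longrightarrow> 1 \<le> i \<Longrightarrow> i \<le> j \<Longrightarrow> j \<le> CARD('m) \<Longrightarrow> l j \<le> l i"
  by (auto simp: ordered_eigensystem_def)

text \<open>Courant-Fischer argument: the span of the top k eigenvectors of \<open>A\<close> and
  that of the eigenvectors of \<open>B\<close> from index k on have dimensions adding up to one more
  than the whole space. At a common nonzero vector the two Rayleigh quotients are compared.\<close>

theorem Weyl_eigenvalue_perturbation: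
  fixes A B :: "real^'m^'m"
  assumes A: "ordered_eigensystem A l v" and B: "ordered_eigensystem B m u" and k: "k \<in> {1..CARD('m)}"
  shows "l k - spectral_norm (A - B) \<le> m k"
proof -
  define V where "V = span (v ` {1..k})"
  define U where "U = span (u ` {k..CARD('m)})"
  have dV: "dim V = k"
    unfolding V_def using dim_span_orthonormal[OF eigensystem_orthonormal[OF A], of "{1..k}"] k by simp
  have dU: "dim U = CARD('m) + 1 - k"
    unfolding U_def using dim_span_orthonormal[OF eigensystem_orthonormal[OF B], of "{k..CARD('m)}"] k by simp
  have "dim {x + y |x y. x \<in> V \<and> y \<in> U} + dim (V \<inter> U) = dim V + dim U"
    by (rule dim_sums_Int) (simp_all add: V_def U_def)
  moreover have "dim {x + y |x y. x \<in> V \<and> y \<in> U} \<le> CARD('m)"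
    using dim_subset_UNIV[of "{x + y |x y. x \<in> V \<and> y \<in> U}"] by simp
  ultimately have "0 < dim (V \<inter> U)"
    using k unfolding dV dU atLeastAtMost_iff by linarith
  hence "\<not> V \<inter> U \<subseteq> {0}"
    by (metis dim_eq_0 less_irrefl)
  then obtain x where x: "x \<in> V" "x \<in> U" "x \<noteq> 0"
    by auto
  have "l k * (norm x)\<^sup>2 \<le> x \<bullet> (A *v x)"
    by (rule eigensystem_quadratic_form_ge[OF A, of "{1..k}"])
       (use x(1) k eigensystem_decreasing[OF A] in \<open>auto simp: V_def\<close>)
  also have "\<dots> = x \<bullet> (B *v x) + x \<bullet> ((A - B) *v x)"
    by (simp add: matrix_vector_mult_diff_rdistrib inner_diff_right)
  also have "\<dots> \<le> m k * (norm x)\<^sup>2 + spectral_norm (A - B) * (norm x)\<^sup>2"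
  proof (rule add_mono)
    show "x \<bullet> (B *v x) \<le> m k * (norm x)\<^sup>2"
      by (rule eigensystem_quadratic_form_le[OF B, of "{k..CARD('m)}"])
         (use x(2) k eigensystem_decreasing[OF B] in \<open>auto simp: U_def\<close>)
    show "x \<bullet> ((A - B) *v x) \<le> spectral_norm (A - B) * (norm x)\<^sup>2"
      using quadratic_form_le_spectral_norm[of x "A - B"] by simp
  qed
  finally have "(l k - spectral_norm (A - B)) * (norm x)\<^sup>2 \<le> m k * (norm x)\<^sup>2"
    by (simp add: algebra_simps)
  thus ?thesis using x(3) by simp
qed

text \<open>
  The Davis-Kahan estimate for two eigenvalue clusters separated by \<open>\<beta> - \<alpha>\<close>: after shifting both
  matrices so that the lower cluster lies in \<open>[-r, r]\<close>, the upper one has inverse norm at most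
  \<open>1 / (r + \<beta> - \<alpha>)\<close>, so the product of the two spectral projectors is controlled by itself.
\<close>

theorem Davis_Kahan:
  fixes A B :: "real^'m^'m"
  assumes A: "ordered_eigensystem A l v" and B: "ordered_eigensystem B m u"
    and J: "J \<subseteq> {1..CARD('m)}" and K: "K \<subseteq> {1..CARD('m)}"
    and low: "\<And>a. a \<in> K \<Longrightarrow> l a \<le> \<alpha>" and high: "\<And>b. b \<in> J \<Longrightarrow> \<beta> \<le> m b" and "\<alpha> < \<beta>"
  shows "(\<beta> - \<alpha>) * norm (span_proj v K (span_proj u J x)) \<le> spectral_norm (A - B) * norm x"
proof -
  let ?I = "{1..CARD('m)}"
  let ?t = "spectral_norm (A - B)"
  note Av = eigensystem_orthonormal[OF A] and Bu = eigensystem_orthonormal[OF B]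
  have finJ: "finite J" and finK: "finite K" using J K finite_subset by auto
  have cle: "norm (span_proj u J y) \<le> norm y" "norm (span_proj v K y) \<le> norm y" for y
    using norm_span_proj_le[OF Bu _ _ J] norm_span_proj_le[OF Av _ _ K] by auto
  define X where "X = span_proj v K \<circ> span_proj u J"
  have "linear X" unfolding X_def by (intro linear_compose linear_span_proj)
  hence bl: "bounded_linear X" by (simp add: linear_conv_bounded_linear)
  define s where "s = onorm X"
  have s: "norm (X y) \<le> s * norm y" for y unfolding s_def by (rule onorm[OF bl])
  have s0: "0 \<le> s" unfolding s_def by (rule onorm_pos_le[OF bl])
  \<comment> \<open>Any r with every \<open>l a\<close> at least \<alpha> - 2r will do. The sum of
    nonnegative terms dominates each of them and also makes sense for empty \<open>K\<close>. The
    centre is then \<open>c\<close>.\<close>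
  define r where "r = (\<Sum>a\<in>K. \<alpha> - l a) / 2"
  define c where "c = \<alpha> - r"
  have r0: "0 \<le> r" unfolding r_def using low by (auto intro!: sum_nonneg)
  have lc: "\<bar>l a - c\<bar> \<le> r" if "a \<in> K" for a
  proof -
    have "\<alpha> - l a \<le> 2 * r"
      unfolding r_def using member_le_sum[OF that, of "\<lambda>a. \<alpha> - l a"] low finK by auto
    thus ?thesis using low[OF that] by (simp add: c_def)
  qed
  define g where "g = \<beta> - \<alpha>"
  have g: "0 < g" using \<open>\<alpha> < \<beta>\<close> by (simp add: g_def)
  have mc: "r + g \<le> m b - c" if "b \<in> J" for b
    using high[OF that] by (simp add: c_def g_def)
  have "norm (X x') \<le> (?t + r * s) / (r + g) * norm x'" for x'
  proof -
    define x where "x = span_proj u J x'"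
    \<comment> \<open>\<open>y\<close> is the inverse of B - c, restricted to the upper cluster,
      applied to the projection of \<open>x'\<close>; by \<open>mc\<close> this inverse has norm at
      most 1/(r + g).\<close>
    define y where "y = (\<Sum>b\<in>J. ((x' \<bullet> u b) / (m b - c)) *\<^sub>R u b)"
    have yu: "y \<bullet> u b = (if b \<in> J then (x' \<bullet> u b) / (m b - c) else 0)" if "b \<in> ?I" for b
      unfolding y_def by (rule orthonormal_sum_inner[OF Bu finJ J that])
    have yJ: "span_proj u J y = y"
      unfolding span_proj_def by (subst (2) y_def, rule sum.cong) (use yu J in auto)
    have "(norm y)\<^sup>2 = (\<Sum>b\<in>J. ((x' \<bullet> u b) / (m b - c))\<^sup>2)"
      unfolding y_def by (rule orthonormal_norm_sum[OF Bu finJ J])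
    also have "\<dots> \<le> (\<Sum>b\<in>J. (x' \<bullet> u b)\<^sup>2 / (r + g)\<^sup>2)"
      unfolding power_divide using mc r0 g
      by (intro sum_mono divide_left_mono power_mono mult_pos_pos zero_less_power) (auto, force)
    also have "\<dots> = (norm (span_proj u J x'))\<^sup>2 / (r + g)\<^sup>2"
      using norm_span_proj[OF Bu _ J] by (simp add: sum_divide_distrib)
    also have "\<dots> \<le> (norm x' / (r + g))\<^sup>2"
      using cle(1)[of x'] by (simp add: power_divide divide_right_mono)
    finally have ny: "norm y \<le> norm x' / (r + g)"
      by (rule power2_le_imp_le) (use r0 g in simp)
    have shift: "B *v y - c *\<^sub>R y = x"
    proof -
      have "B *v y - c *\<^sub>R y = span_proj u ?I (B *v y - c *\<^sub>R y)"
        using span_proj_full(1)[OF Bu] by simp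
      also have "\<dots> = (\<Sum>b\<in>?I. if b \<in> J then (x' \<bullet> u b) *\<^sub>R u b else 0)"
        unfolding span_proj_def
      proof (rule sum.cong)
        fix b assume b: "b \<in> ?I"
        have "(B *v y - c *\<^sub>R y) \<bullet> u b = (m b - c) * (y \<bullet> u b)"
          by (simp add: inner_diff_left eigensystem_inner[OF B b] algebra_simps)
        also have "\<dots> = (if b \<in> J then x' \<bullet> u b else 0)"
          unfolding yu[OF b] using mc[of b] r0 g by auto
        finally show "((B *v y - c *\<^sub>R y) \<bullet> u b) *\<^sub>R u b = (if b \<in> J then (x' \<bullet> u b) *\<^sub>R u b else 0)"
          by simp
      qed simp
      also have "\<dots> = x"
        unfolding x_def span_proj_def using J by (simp add: sum.inter_restrict[symmetric] inf_absorb2)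
      finally show ?thesis .
    qed
    have "X x' = span_proj v K (B *v y - c *\<^sub>R y)"
      by (simp add: X_def shift x_def)
    also have "\<dots> = span_proj v K ((B - A) *v y) + span_proj v K (A *v y - c *\<^sub>R y)"
      by (simp add: span_proj_add[symmetric] matrix_vector_mult_diff_rdistrib)
    finally have "norm (X x') \<le> norm (span_proj v K ((B - A) *v y)) + norm (span_proj v K (A *v y - c *\<^sub>R y))"
      using norm_triangle_ineq by metis
    also have "norm (span_proj v K ((B - A) *v y)) \<le> ?t * norm y"
      using cle(2) norm_mult_le_spectral_norm[of "B - A" y] spectral_norm_minus_commute[of A B]
      by (metis order_trans)
    also have "norm (span_proj v K (A *v y - c *\<^sub>R y)) \<le> r * norm (span_proj v K y)"
    proof (rule power2_le_imp_le)
      have "(norm (span_proj v K (A *v y - c *\<^sub>R y)))\<^sup>2 = (\<Sum>a\<in>K. (l a - c)\<^sup>2 * (y \<bullet> v a)\<^sup>2)"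
        unfolding norm_span_proj[OF Av _ K, simplified] using K
        by (intro sum.cong) (auto simp: inner_diff_left eigensystem_inner[OF A] power_mult_distrib[symmetric] algebra_simps)
      also have "\<dots> \<le> (\<Sum>a\<in>K. r\<^sup>2 * (y \<bullet> v a)\<^sup>2)"
        using lc r0 by (intro sum_mono mult_right_mono) (auto simp: abs_le_square_iff[symmetric])
      finally show "(norm (span_proj v K (A *v y - c *\<^sub>R y)))\<^sup>2 \<le> (r * norm (span_proj v K y))\<^sup>2"
        using norm_span_proj[OF Av _ K] by (simp add: power_mult_distrib sum_distrib_left)
    qed (use r0 in simp)
    \<comment> \<open>\<open>y\<close> already lies in the range of the projector for
      \<open>J\<close>, so the norm \<open>s\<close> reappears on the right and the estimate bounds
      \<open>s\<close> by itself.\<close>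
    also have "span_proj v K y = X y" by (simp add: X_def yJ)
    also have "?t * norm y + r * norm (X y) \<le> ?t * norm y + r * (s * norm y)"
      using s r0 by (intro add_left_mono mult_left_mono)
    also have "\<dots> = (?t + r * s) * norm y" by (simp add: algebra_simps)
    also have "\<dots> \<le> (?t + r * s) * (norm x' / (r + g))"
      using ny s0 r0 spectral_norm_nonneg by (intro mult_left_mono add_nonneg_nonneg mult_nonneg_nonneg) auto
    finally show ?thesis by simp
  qed
  moreover have "0 \<le> (?t + r * s) / (r + g)"
    using s0 r0 g spectral_norm_nonneg[of "A - B"] by simp
  ultimately have "s \<le> (?t + r * s) / (r + g)"
    unfolding s_def by (intro onorm_bound)
  \<comment> \<open>Clearing the denominator cancels \<open>r * s\<close>, so the spread of the
    lower cluster disappears.\<close>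
  hence "g * s \<le> ?t"
    using r0 g by (simp add: field_simps)
  moreover have "g * norm (X x) \<le> g * s * norm x"
    using s[of x] g by simp
  ultimately have "g * norm (X x) \<le> ?t * norm x"
    by (meson mult_right_mono norm_ge_zero order_trans)
  thus ?thesis by (simp add: X_def g_def)
qed

text \<open>By Weyl, each upper cluster stays at distance d - t from the other matrix's lower
  cluster, so Davis-Kahan applies in both directions with constant t/(d - t). These bound the two
  mixed products of projectors, which together give the difference of the projectors.\<close>

theorem dominant_subspace_perturbation:
  fixes A B :: "real^'m^'m"
  assumes A: "ordered_eigensystem A l v" and B: "ordered_eigensystem B m u"
    and k: "1 \<le> k" "k < CARD('m)" and gap: "2 * spectral_norm (A - B) < l k - l (k + 1)"
  shows "m (k + 1) < m k"
    and "spectral_norm (orth_proj (span (v ` {1..k})) - orth_proj (span (u ` {1..k})))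
           \<le> 2 * spectral_norm (A - B) / (l k - l (k + 1))"
proof -
  let ?I = "{1..CARD('m)}" and ?J = "{1..k}" and ?K = "{k+1..CARD('m)}"
  let ?t = "spectral_norm (A - B)"
  note Av = eigensystem_orthonormal[OF A] and Bu = eigensystem_orthonormal[OF B]
  have JI: "?J \<subseteq> ?I" and KI: "?K \<subseteq> ?I" and IJ: "?I - ?J = ?K" using k by auto
  define d where "d = l k - l (k + 1)"
  define s where "s = ?t / (d - ?t)"
  have t: "0 \<le> ?t" "?t < d - ?t" "0 < d - ?t"
    using gap spectral_norm_nonneg[of "A - B"] unfolding d_def by linarith+
  have mk: "l k - ?t \<le> m k"
    using Weyl_eigenvalue_perturbation[OF A B] k by auto
  have mk1: "m (k + 1) \<le> l (k + 1) + ?t"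
    using Weyl_eigenvalue_perturbation[OF B A, of "k + 1"] k spectral_norm_minus_commute[of A B] by auto
  show "m (k + 1) < m k"
    using mk mk1 gap by linarith
  have p1: "norm (span_proj v ?K (span_proj u ?J x)) \<le> s * norm x" for x
  proof -
    have "(l k - ?t - l (k + 1)) * norm (span_proj v ?K (span_proj u ?J x)) \<le> ?t * norm x"
    proof (rule Davis_Kahan[OF A B JI KI])
      show "l a \<le> l (k + 1)" if "a \<in> ?K" for a using eigensystem_decreasing[OF A] that by auto
      show "l k - ?t \<le> m b" if "b \<in> ?J" for b
        using eigensystem_decreasing[OF B, of b k] that mk k by auto
    qed (use t d_def in linarith)
    thus ?thesis using t by (simp add: s_def d_def field_simps)
  qed
  have p2: "norm (span_proj u ?K (span_proj v ?J x)) \<le> s * norm x" for x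
  proof -
    have "(l k - (l (k + 1) + ?t)) * norm (span_proj u ?K (span_proj v ?J x)) \<le> spectral_norm (B - A) * norm x"
    proof (rule Davis_Kahan[OF B A JI KI])
      show "m a \<le> l (k + 1) + ?t" if "a \<in> ?K" for a
        using eigensystem_decreasing[OF B, of "k + 1" a] that mk1 by auto
      show "l k \<le> l b" if "b \<in> ?J" for b
        using eigensystem_decreasing[OF A, of b k] that k by auto
    qed (use t d_def in linarith)
    thus ?thesis using t by (simp add: s_def d_def field_simps spectral_norm_minus_commute[of B A])
  qed
  have s0: "0 \<le> s" using t by (simp add: s_def)
  \<comment> \<open>The operator here is the adjoint of the one in \<open>p2\<close> and so obeys
    the same bound.\<close>
  have p3: "norm (span_proj v ?J (span_proj u ?K x)) \<le> s * norm x" for x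
  proof -
    let ?w = "span_proj v ?J (span_proj u ?K x)"
    have "(norm ?w)\<^sup>2 = ?w \<bullet> span_proj u ?K x"
      unfolding power2_norm_eq_inner
      by (metis span_proj_selfadjoint span_proj_idem[OF Av _ JI] finite_atLeastAtMost inner_commute)
    also have "\<dots> = span_proj u ?K (span_proj v ?J ?w) \<bullet> x"
      unfolding span_proj_idem[OF Av finite_atLeastAtMost JI] by (rule span_proj_selfadjoint[symmetric])
    also have "\<dots> \<le> norm (span_proj u ?K (span_proj v ?J ?w)) * norm x"
      by (rule norm_cauchy_schwarz)
    also have "\<dots> \<le> s * norm ?w * norm x"
      by (intro mult_right_mono p2) simp
    finally show ?thesis
      by (cases "norm ?w = 0") (simp_all add: power2_eq_square s0)
  qed
  have "norm ((orth_proj (span (v ` ?J)) - orth_proj (span (u ` ?J))) *v x) \<le> s * norm x" for x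
  proof -
    have vK: "span_proj v ?K y = y - span_proj v ?J y" and uK: "span_proj u ?K y = y - span_proj u ?J y" for y
      using span_proj_compl[OF Av finite_atLeastAtMost _ JI, unfolded IJ]
        span_proj_compl[OF Bu finite_atLeastAtMost _ JI, unfolded IJ] by simp_all
    \<comment> \<open>For projectors P, Q one has P - Q = P(1 - Q) - (1 - P)Q. The two terms have
      orthogonal ranges and act on orthogonal parts of \<open>x\<close>, so the bounds combine by
      Pythagoras without a factor 2.\<close>
    define a where "a = span_proj v ?J (span_proj u ?K x)"
    define b where "b = span_proj v ?K (span_proj u ?J x)"
    have eq: "(orth_proj (span (v ` ?J)) - orth_proj (span (u ` ?J))) *v x = a - b"
      unfolding matrix_vector_mult_diff_rdistrib orth_proj_span[OF Av finite_atLeastAtMost JI]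
        orth_proj_span[OF Bu finite_atLeastAtMost JI] a_def b_def vK uK span_proj_diff by simp
    have "a \<bullet> b = span_proj u ?K x \<bullet> span_proj v ?J b"
      unfolding a_def by (rule span_proj_selfadjoint)
    also have "span_proj v ?J b = 0"
      unfolding b_def vK span_proj_diff span_proj_idem[OF Av finite_atLeastAtMost JI] by simp
    finally have ab: "a \<bullet> b = 0" by simp
    have "(norm (a - b))\<^sup>2 = (norm a)\<^sup>2 + (norm b)\<^sup>2"
      using ab by (simp add: power2_norm_eq_inner inner_diff_left inner_diff_right inner_commute)
    also have "\<dots> \<le> (s * norm (span_proj u ?K x))\<^sup>2 + (s * norm (span_proj u ?J x))\<^sup>2"
    proof (intro add_mono power_mono)
      show "norm a \<le> s * norm (span_proj u ?K x)"
        using p3[of "span_proj u ?K x"] unfolding a_def span_proj_idem[OF Bu finite_atLeastAtMost KI] .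
      show "norm b \<le> s * norm (span_proj u ?J x)"
        using p1[of "span_proj u ?J x"] unfolding b_def span_proj_idem[OF Bu finite_atLeastAtMost JI] .
    qed simp_all
    also have "\<dots> = s\<^sup>2 * ((norm (span_proj u ?K x))\<^sup>2 + (norm (span_proj u ?J x))\<^sup>2)"
      by (simp add: power_mult_distrib algebra_simps)
    also have "(norm (span_proj u ?K x))\<^sup>2 + (norm (span_proj u ?J x))\<^sup>2 = (norm x)\<^sup>2"
    proof -
      have "span_proj u ?J x \<bullet> span_proj u ?J x = x \<bullet> span_proj u ?J x"
        unfolding span_proj_selfadjoint span_proj_idem[OF Bu finite_atLeastAtMost JI] by (rule refl)
      thus ?thesis
        unfolding uK by (simp add: power2_norm_eq_inner inner_diff_left inner_diff_right inner_commute)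
    qed
    finally have "(norm (a - b))\<^sup>2 \<le> (s * norm x)\<^sup>2" by (simp add: power_mult_distrib)
    thus ?thesis unfolding eq by (rule power2_le_imp_le) (simp add: s0)
  qed
  hence "spectral_norm (orth_proj (span (v ` ?J)) - orth_proj (span (u ` ?J))) \<le> s"
    by (rule spectral_norm_le[OF s0])
  \<comment> \<open>The gap condition says t < d/2, hence d - t > d/2.\<close>
  also have "s \<le> 2 * ?t / d"
  proof -
    have "?t * d \<le> ?t * (2 * (d - ?t))"
      using t by (intro mult_left_mono) auto
    thus ?thesis using t by (simp add: s_def field_simps)
  qed
  finally show "spectral_norm (orth_proj (span (v ` ?J)) - orth_proj (span (u ` ?J))) \<le> 2 * ?t / (l k - l (k + 1))"
    by (simp add: d_def)
qed

section \<open>The one-step estimate\<close>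

lemma continuous_on_exp_banach:
  fixes f :: "'b::topological_space \<Rightarrow> 'a::{real_normed_algebra_1,banach}"
  assumes "continuous_on S f"
  shows "continuous_on S (\<lambda>x. exp (f x))"
proof -
  have "isCont exp A" for A :: 'a
  proof -
    let ?S = "ball 0 (norm A + 1) :: 'a set"
    have "continuous_on ?S (\<lambda>x. \<Sum>n. x ^ n /\<^sub>R fact n)"
    proof (rule uniform_limit_theorem)
      show "uniform_limit ?S (\<lambda>n x. \<Sum>i<n. x ^ i /\<^sub>R fact i) (\<lambda>x. \<Sum>n. x ^ n /\<^sub>R fact n) sequentially"
      proof (rule Weierstrass_m_test)
        show "norm (x ^ n /\<^sub>R fact n) \<le> (norm A + 1) ^ n /\<^sub>R fact n" if "x \<in> ?S" for n x
          using that order_trans[OF norm_power_ineq power_mono[of "norm x" "norm A + 1" n]]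
          by (simp add: divide_right_mono)
        show "summable (\<lambda>n. (norm A + 1) ^ n /\<^sub>R fact n)"
          by (rule summable_exp_generic)
      qed
      show "\<forall>\<^sub>F n in sequentially. continuous_on ?S (\<lambda>x. \<Sum>i<n. x ^ i /\<^sub>R fact i)"
        by (intro always_eventually allI continuous_intros)
    qed simp
    thus ?thesis
      using continuous_on_interior[of ?S "\<lambda>x. \<Sum>n. x ^ n /\<^sub>R fact n" A] by (simp add: exp_def[abs_def])
  qed
  hence "continuous_on UNIV (exp :: 'a \<Rightarrow> 'a)"
    by (simp add: continuous_at_imp_continuous_on)
  from continuous_on_compose2[OF this assms] show ?thesis by simp
qed

section \<open>Matrices as endomorphisms\<close>

definition mat_endo :: "real^'m^'m \<Rightarrow> (real^'m) endo" where
  "mat_endo A = endo_of ((*v) A)"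

lemma app_mat_endo [simp]: "app (mat_endo A) x = A *v x"
  by (simp add: mat_endo_def app_endo_of)

lemma mat_endo_simps:
  "mat_endo (A + B) = mat_endo A + mat_endo B" "mat_endo (A - B) = mat_endo A - mat_endo B"
  "mat_endo (r *\<^sub>R A) = r *\<^sub>R mat_endo A" "mat_endo 0 = 0"
  by (rule endo_eqI, simp add: matrix_vector_mult_add_rdistrib matrix_vector_mult_diff_rdistrib
      scaleR_matrix_vector_assoc)+

lemma linear_mat_endo: "linear mat_endo"
  by (rule linearI) (simp_all add: mat_endo_simps)

lemma bounded_linear_mat_endo: "bounded_linear mat_endo"
  using linear_mat_endo by (simp add: linear_conv_bounded_linear)

lemma norm_mat_endo: "norm (mat_endo A) = spectral_norm A"
proof (rule antisym)
  show "norm (mat_endo A) \<le> spectral_norm A"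
    by (rule norm_endo_bound) (simp_all add: spectral_norm_nonneg norm_mult_le_spectral_norm)
  show "spectral_norm A \<le> norm (mat_endo A)"
    by (rule spectral_norm_le) (simp_all add: norm_app flip: app_mat_endo)
qed

lemma tr_mat_endo: "tr (mat_endo A) = trace A"
proof -
  have "(\<Sum>b\<in>Basis. b \<bullet> (A *v b)) = (\<Sum>i\<in>UNIV. axis i 1 \<bullet> (A *v axis i 1))"
  proof (rule sum.reindex_cong[of "\<lambda>i. axis i 1"])
    show "inj (\<lambda>i. axis i 1 :: real^'m)" by (auto simp: inj_on_def axis_eq_axis)
    show "Basis = range (\<lambda>i. axis i 1 :: real^'m)" by (auto simp: Basis_vec_def)
  qed simp
  thus ?thesis
    by (simp add: tr_def trace_def matrix_vector_mult_basis column_def inner_axis')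
qed

lemma adj_mat_endo: "adj (mat_endo A) = mat_endo (transpose A)"
  by (rule adj_unique) (simp, metis dot_lmul_matrix inner_commute)

lemma outer_mult [simp]: "outer z z *v x = (z \<bullet> x) *\<^sub>R z"
  by (vector outer_def matrix_vector_mult_def inner_vec_def sum_distrib_left sum_distrib_right mult_ac)

lemma transpose_outer [simp]: "transpose (outer z z) = outer z z"
  by (simp add: outer_def transpose_def vec_eq_iff mult.commute)

text \<open>Computed in the eigenbasis of \<open>E\<close>, the trace is a sum of eigenvalues
  weighted by the nonnegative diagonal entries of \<open>P\<close>.\<close>

lemma tr_mult_eigensystem_le:
  fixes E :: "real^'m^'m"
  assumes es: "ordered_eigensystem E l v" and P: "\<And>x. 0 \<le> x \<bullet> app P x"
  shows "tr (P * mat_endo E) \<le> spectral_norm E * tr P"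
proof -
  let ?I = "{1..CARD('m)}"
  note on = eigensystem_orthonormal[OF es]
  note im = orthonormal_image[OF on finite_atLeastAtMost]
  have tr: "tr A = (\<Sum>i\<in>?I. v i \<bullet> app A (v i))" for A
  proof -
    have "tr A = (\<Sum>b\<in>v ` ?I. b \<bullet> app A b)"
      by (rule tr_orthonormal_basis) (use im span_proj_full(2)[OF on] in auto)
    thus ?thesis by (simp only: sum.reindex[OF im(1)] o_def)
  qed
  have ev: "E *v v i = l i *\<^sub>R v i" "l i \<le> spectral_norm E" if "i \<in> ?I" for i
  proof -
    show "E *v v i = l i *\<^sub>R v i" using es that by (simp add: ordered_eigensystem_def)
    thus "l i \<le> spectral_norm E"
      using quadratic_form_le_spectral_norm[of "v i" E] on that
      by (auto simp: orthonormal_on_def norm_eq_sqrt_inner)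
  qed
  have "(\<Sum>i\<in>?I. l i * (v i \<bullet> app P (v i))) \<le> (\<Sum>i\<in>?I. spectral_norm E * (v i \<bullet> app P (v i)))"
    using ev(2) P by (intro sum_mono mult_right_mono) auto
  thus ?thesis
    unfolding tr sum_distrib_left by (simp add: ev(1) app_linear_simps)
qed

text \<open>
  The coefficient of the centred summand \<open>D\<close> in the one-step estimate; it depends only on the
  past \<open>Y\<close>, so the term \<open>tr (step_gradient \<tau> L F Y * D)\<close> has mean zero.
\<close>

definition step_gradient :: "real \<Rightarrow> real \<Rightarrow> 'a::euclidean_space endo \<Rightarrow> 'a endo \<Rightarrow> 'a endo" where
  "step_gradient \<tau> L F Y =
     \<tau> *\<^sub>R (exp Y - 1) + \<tau>\<^sup>2 *\<^sub>R (L\<^sup>2 *\<^sub>R exp Y - F * exp Y - exp Y * F)"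

text \<open>Golden-Thompson splits off the new summand and a quadratic polynomial replaces its
  exponential. The bound is affine in \<open>D\<close> with coefficients that depend on
  \<open>Y\<close>, so independence suffices to take its expectation.\<close>

lemma exp_excess_step:
  fixes E :: "real^'m^'m" and z :: "real^'m"
  assumes E: "sym_psd E" and es: "ordered_eigensystem E l v" and EL: "spectral_norm E \<le> L\<^sup>2"
    and z: "norm z \<le> L" and \<tau>: "4 * \<bar>\<tau>\<bar> * L\<^sup>2 \<le> 1" and Y: "adj Y = Y"
  defines "F \<equiv> mat_endo E" and "D \<equiv> mat_endo (outer z z - E)"
  shows "exp_excess (Y + \<tau> *\<^sub>R D) \<le>
    (1 + \<tau>\<^sup>2 * L\<^sup>2 * spectral_norm E) * exp_excess Y + \<tau>\<^sup>2 * L\<^sup>2 * trace E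
      + \<tau>\<^sup>2 * L\<^sup>2 * tr (Y * F) + tr (step_gradient \<tau> L F Y * D)"
proof -
  define W where "W = mat_endo (outer z z)"
  define P where "P = exp Y"
  let ?X = "\<tau> *\<^sub>R D"
  have D: "D = W - F" by (simp add: D_def W_def F_def mat_endo_simps)
  have W: "app W x = (z \<bullet> x) *\<^sub>R z" for x by (simp add: W_def)
  have adjW: "adj W = W" by (simp add: W_def adj_mat_endo)
  have adjF: "adj F = F" using E by (simp add: F_def adj_mat_endo sym_psd_def)
  have adjX: "adj ?X = ?X" by (simp add: D adjW adjF)
  have "norm (app W x) \<le> L\<^sup>2 * norm x" for x
  proof -
    have "norm (app W x) \<le> norm z * norm x * norm z"
      unfolding W norm_scaleR by (intro mult_right_mono Cauchy_Schwarz_ineq2) simp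
    also have "\<dots> = (norm z)\<^sup>2 * norm x" by (simp add: power2_eq_square)
    finally show ?thesis
      using power_mono[OF z, of 2] by (meson mult_right_mono norm_ge_zero order_trans)
  qed
  hence "norm W \<le> L\<^sup>2" by (intro norm_endo_bound) simp_all
  hence "norm D \<le> 2 * L\<^sup>2"
    using norm_triangle_ineq4[of W F] EL by (simp add: D F_def norm_mat_endo)
  \<comment> \<open>Both \<open>W\<close> and \<open>F\<close> have norm at most L^2; this is the
    source of the 4 in the condition on \<tau>.\<close>
  hence "\<bar>\<tau>\<bar> * norm D \<le> \<bar>\<tau>\<bar> * (2 * L\<^sup>2)" by (intro mult_left_mono) simp_all
  hence nX: "norm ?X \<le> 1 / 2" using \<tau> by simp
  \<comment> \<open>This is the square of W - F with W^2 = |z|^2 W enlarged to L^2 W, which makes it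
    affine in the random part \<open>W\<close>.\<close>
  define V where "V = L\<^sup>2 *\<^sub>R W - W * F - F * W + F * F"
  have sq: "app D x \<bullet> app D x \<le> x \<bullet> app V x" for x
  proof -
    have "x \<bullet> app V x - app D x \<bullet> app D x = (L\<^sup>2 - (norm z)\<^sup>2) * (z \<bullet> x)\<^sup>2"
      using adj_inner[of x F "app F x"] adj_inner[of x F z] adjF
      by (simp add: V_def D W app_linear_simps inner_simps power2_norm_eq_inner inner_commute algebra_simps)
        (simp add: power2_eq_square)
    moreover have "0 \<le> L\<^sup>2 - (norm z)\<^sup>2" using power_mono[OF z, of 2] by simp
    ultimately show ?thesis by (metis diff_ge_0_iff_ge mult_nonneg_nonneg zero_le_power2)
  qed
  have "tr (exp (Y + ?X)) \<le> tr (P * exp ?X)"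
    unfolding P_def by (rule golden_thompson[OF Y adjX])
  also have "\<dots> \<le> tr (P * (1 + ?X + \<tau>\<^sup>2 *\<^sub>R V))"
    unfolding P_def
  proof (rule tr_exp_mult_mono[OF Y])
    fix x
    have "app ?X x \<bullet> app ?X x \<le> \<tau>\<^sup>2 * (x \<bullet> app V x)"
      using mult_left_mono[OF sq[of x], of "\<tau>\<^sup>2"] by (simp add: power2_eq_square mult.assoc)
    thus "x \<bullet> app (exp ?X) x \<le> x \<bullet> app (1 + ?X + \<tau>\<^sup>2 *\<^sub>R V) x"
      using exp_quadratic_form_le[OF adjX nX, of x] by (simp add: inner_add_right)
  qed
  also have "\<dots> = tr P + \<tau> * tr (P * D) + \<tau>\<^sup>2 * tr (P * V)"
    by (simp add: distrib_left)
  also have "tr (P * V) = L\<^sup>2 * tr (P * D) - tr (F * P * D) - tr (P * F * D) + L\<^sup>2 * tr (P * F) - tr (P * (F * F))"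
  proof -
    \<comment> \<open>Recentred at \<open>D\<close>: the terms containing \<open>D\<close> go into
      the gradient, and the rest is at most L^2 F because F^2 is positive.\<close>
    have "V = L\<^sup>2 *\<^sub>R D - D * F - F * D + L\<^sup>2 *\<^sub>R F - F * F"
      by (simp add: V_def D algebra_simps)
    moreover have "tr (P * (D * F)) = tr (F * P * D)"
      by (metis mult.assoc tr_commute)
    ultimately show ?thesis by (simp add: distrib_left right_diff_distrib mult.assoc)
  qed
  also have "tr P + \<tau> * tr (P * D) + \<tau>\<^sup>2 * \<dots> \<le> tr P + \<tau> * tr (P * D)
      + \<tau>\<^sup>2 * (L\<^sup>2 * tr (P * D) - tr (F * P * D) - tr (P * F * D)
        + L\<^sup>2 * (spectral_norm E * exp_excess Y + trace E + tr (Y * F)))"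
  proof (intro add_left_mono mult_left_mono)
    have "tr (P * 0) \<le> tr (P * (F * F))"
      unfolding P_def
    proof (rule tr_exp_mult_mono[OF Y])
      show "x \<bullet> app 0 x \<le> x \<bullet> app (F * F) x" for x
        using adj_inner[of x F "app F x"] adjF by simp
    qed
    moreover have "L\<^sup>2 * tr (P * F) \<le> L\<^sup>2 * (spectral_norm E * exp_excess Y + trace E + tr (Y * F))"
    proof (rule mult_left_mono)
      have "tr ((P - 1 - Y) * F) \<le> spectral_norm E * tr (P - 1 - Y)"
        unfolding F_def
      proof (rule tr_mult_eigensystem_le[OF es])
        show "0 \<le> x \<bullet> app (P - 1 - Y) x" for x
          using exp_quadratic_form_ge[OF Y, of x] by (simp add: P_def inner_diff_right)
      qed
      thus "tr (P * F) \<le> spectral_norm E * exp_excess Y + trace E + tr (Y * F)"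
        by (simp add: exp_excess_def P_def left_diff_distrib F_def tr_mat_endo)
    qed simp
    ultimately show "L\<^sup>2 * tr (P * D) - tr (F * P * D) - tr (P * F * D) + L\<^sup>2 * tr (P * F) - tr (P * (F * F))
      \<le> L\<^sup>2 * tr (P * D) - tr (F * P * D) - tr (P * F * D)
        + L\<^sup>2 * (spectral_norm E * exp_excess Y + trace E + tr (Y * F))" by simp
  qed simp
  finally show ?thesis
    by (simp add: exp_excess_def step_gradient_def P_def algebra_simps)
qed

lemma continuous_on_exp_excess [continuous_intros]:
  "continuous_on S f \<Longrightarrow> continuous_on S (\<lambda>x. exp_excess (f x))"
  unfolding exp_excess_def
  by (intro bounded_linear.continuous_on[OF bounded_linear_tr] continuous_intros continuous_on_exp_banach)

lemma continuous_on_mat_endo: "continuous_on S f \<Longrightarrow> continuous_on S (\<lambda>x. mat_endo (f x))"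
  by (rule bounded_linear.continuous_on[OF bounded_linear_mat_endo])

lemma exp_excess_nonneg: "adj A = A \<Longrightarrow> 0 \<le> exp_excess A"
  unfolding exp_excess_def tr_def
proof (rule sum_nonneg)
  show "0 \<le> b \<bullet> app (exp A - 1 - A) b" if "adj A = A" for b
    using exp_quadratic_form_ge[OF that, of b] by (simp add: inner_diff_right)
qed

section \<open>Concentration of the sample second moment\<close>

lemma continuous_bounded_on_ball:
  fixes f :: "'b::euclidean_space \<Rightarrow> 'c::real_normed_vector"
  assumes "continuous_on UNIV f"
  obtains B where "\<And>x. norm x \<le> K \<Longrightarrow> norm (f x) \<le> B"
proof -
  have "compact (f ` cball 0 K)"
    by (intro compact_continuous_image continuous_on_subset[OF assms]) auto
  then obtain B where "\<forall>y\<in>f ` cball 0 K. norm y \<le> B"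
    using compact_imp_bounded bounded_iff by blast
  thus ?thesis by (intro that[of B]) auto
qed

lemma linear_sum_Basis:
  fixes T :: "'b::euclidean_space \<Rightarrow> 'c::real_vector"
  assumes "linear T"
  shows "T u = (\<Sum>b\<in>Basis. (u \<bullet> b) *\<^sub>R T b)"
proof -
  have "T u = T (\<Sum>b\<in>Basis. (u \<bullet> b) *\<^sub>R b)" by (simp add: euclidean_representation)
  thus ?thesis by (simp add: linear_sum[OF assms] linear_scale[OF assms])
qed

context prob_space
begin

lemma integrable_continuous_bounded:
  fixes f :: "'b::euclidean_space \<Rightarrow> 'c::{banach, second_countable_topology}"
  assumes f: "continuous_on UNIV f" and X: "random_variable borel X" and K: "AE \<omega> in M. norm (X \<omega>) \<le> K"
  shows "integrable M (\<lambda>\<omega>. f (X \<omega>))"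
proof -
  obtain B where B: "\<And>x. norm x \<le> K \<Longrightarrow> norm (f x) \<le> B"
    using continuous_bounded_on_ball[OF f, of K] by blast
  show ?thesis
  proof (rule integrable_const_bound)
    show "AE \<omega> in M. norm (f (X \<omega>)) \<le> B" using K by eventually_elim (rule B)
    show "random_variable borel (\<lambda>\<omega>. f (X \<omega>))"
      using X borel_measurable_continuous_onI[OF f] by (rule measurable_compose)
  qed
qed

lemma has_expectation_const: "has_bochner_integral M (\<lambda>_. c) c"
  for c :: "'c::{banach, second_countable_topology}"
  by (simp add: has_bochner_integral_iff prob_space)

lemma indep_var_sum:
  fixes X :: "'i \<Rightarrow> 'a \<Rightarrow> 'b::{second_countable_topology, topological_comm_monoid_add}"
  assumes "finite I" "i \<notin> I" and indep: "indep_vars (\<lambda>_. borel) X (insert i I)"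
  shows "indep_var borel (\<lambda>\<omega>. \<Sum>j\<in>I. X j \<omega>) borel (X i)"
proof -
  have "indep_var
    borel ((\<lambda>f. \<Sum>j\<in>I. f j) \<circ> (\<lambda>\<omega>. restrict (\<lambda>j. X j \<omega>) I))
    borel ((\<lambda>f. f i) \<circ> (\<lambda>\<omega>. restrict (\<lambda>j. X j \<omega>) {i}))"
    using assms by (intro indep_var_compose[OF indep_var_restrict[OF indep]]) auto
  thus ?thesis by (simp add: comp_def)
qed

text \<open>In coordinates, the value is a sum of products of a bounded function of \<open>X\<close>
  with a centred component of \<open>U\<close>. Each product has mean zero by independence, which
  takes the place of conditioning on the past.\<close>

lemma indep_centred_linear:
  fixes X U :: "'a \<Rightarrow> 'b::euclidean_space" and T :: "'b \<Rightarrow> 'b \<Rightarrow> real"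
  assumes indep: "indep_var borel X borel U" and K: "AE \<omega> in M. norm (X \<omega>) \<le> K"
    and U: "has_bochner_integral M U 0"
    and lin: "\<And>x. linear (T x)" and cont: "\<And>u. continuous_on UNIV (\<lambda>x. T x u)"
  shows "has_bochner_integral M (\<lambda>\<omega>. T (X \<omega>) (U \<omega>)) 0"
proof -
  have X: "random_variable borel X" using indep by (rule indep_var_rv1)
  have "has_bochner_integral M (\<lambda>\<omega>. T (X \<omega>) b * (U \<omega> \<bullet> b)) 0" for b
  proof -
    have i: "indep_var borel ((\<lambda>x. T x b) \<circ> X) borel ((\<lambda>u. u \<bullet> b) \<circ> U)"
      by (intro indep_var_compose[OF indep] borel_measurable_continuous_onI cont continuous_intros)
    have iX: "integrable M ((\<lambda>x. T x b) \<circ> X)"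
      unfolding comp_def by (rule integrable_continuous_bounded[OF cont X K])
    have Ub: "has_bochner_integral M (\<lambda>\<omega>. U \<omega> \<bullet> b) 0"
      using has_bochner_integral_inner_left[of b M U 0] U by simp
    hence iU: "integrable M ((\<lambda>u. u \<bullet> b) \<circ> U)" and "expectation (\<lambda>\<omega>. U \<omega> \<bullet> b) = 0"
      unfolding comp_def by (auto simp: has_bochner_integral_iff)
    thus ?thesis
      using indep_var_lebesgue_integral[OF i iX iU] indep_var_integrable[OF i iX iU]
      by (simp add: has_bochner_integral_iff)
  qed
  hence "has_bochner_integral M (\<lambda>\<omega>. \<Sum>b\<in>Basis. T (X \<omega>) b * (U \<omega> \<bullet> b)) (\<Sum>b\<in>(Basis::'b set). 0)"
    by (rule has_bochner_integral_sum)
  moreover have "T (X \<omega>) (U \<omega>) = (\<Sum>b\<in>Basis. T (X \<omega>) b * (U \<omega> \<bullet> b))" for \<omega>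
    using linear_sum_Basis[OF lin, of "X \<omega>" "U \<omega>"] by (simp add: mult.commute)
  ultimately show ?thesis by simp
qed

end

lemma eigenvalue_eq_quadratic_form:
  fixes A :: "real^'m^'m"
  shows "ordered_eigensystem A l v \<Longrightarrow> i \<in> {1..CARD('m)} \<Longrightarrow> l i = v i \<bullet> (A *v v i)"
  by (simp add: ordered_eigensystem_def)

lemma psd_eigenvalue_nonneg:
  fixes A :: "real^'m^'m"
  shows "sym_psd A \<Longrightarrow> ordered_eigensystem A l v \<Longrightarrow> i \<in> {1..CARD('m)} \<Longrightarrow> 0 \<le> l i"
  using eigenvalue_eq_quadratic_form[of A l v i] by (simp add: sym_psd_def)

lemma spectral_norm_le_top_eigenvalue:
  fixes A :: "real^'m^'m"
  assumes A: "sym_psd A" and es: "ordered_eigensystem A l v"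
  shows "spectral_norm A \<le> l 1"
proof (rule spectral_norm_le)
  have I1: "1 \<in> {1..CARD('m)}" using one_le_card_finite by auto
  show l1: "0 \<le> l 1" by (rule psd_eigenvalue_nonneg[OF A es I1])
  fix x
  have "(norm (A *v x))\<^sup>2 = (\<Sum>i\<in>{1..CARD('m)}. (l i)\<^sup>2 * (x \<bullet> v i)\<^sup>2)"
    unfolding eigensystem_norm_eq[OF es]
    by (rule sum.cong) (simp_all add: eigensystem_inner[OF es] power_mult_distrib)
  also have "\<dots> \<le> (\<Sum>i\<in>{1..CARD('m)}. (l 1)\<^sup>2 * (x \<bullet> v i)\<^sup>2)"
    using psd_eigenvalue_nonneg[OF A es] eigensystem_decreasing[OF es, of 1]
    by (intro sum_mono mult_right_mono power_mono) auto
  also have "\<dots> = (l 1 * norm x)\<^sup>2"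
    by (simp add: power_mult_distrib eigensystem_norm_eq[OF es, of x] sum_distrib_left)
  finally show "norm (A *v x) \<le> l 1 * norm x"
    by (rule power2_le_imp_le) (intro mult_nonneg_nonneg l1 norm_ge_zero)
qed

lemma continuous_on_outer: "continuous_on UNIV (\<lambda>z :: real^'m. outer z z)"
  unfolding outer_def by (intro continuous_intros continuous_on_vec_lambda)

section \<open>The random potential and its recursion\<close>

locale second_moment_sample = prob_space M
  for M :: "'a measure" and z :: "nat \<Rightarrow> 'a \<Rightarrow> real^'m" and n :: nat and E :: "real^'m^'m"
    and L :: real and l :: "nat \<Rightarrow> real" and v :: "nat \<Rightarrow> real^'m" +
  assumes indep: "indep_vars (\<lambda>_. borel) z {1..n}"
    and moment: "\<And>j. j \<in> {1..n} \<Longrightarrow> has_bochner_integral M (\<lambda>\<omega>. outer (z j \<omega>) (z j \<omega>)) E"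
    and bounded: "AE \<omega> in M. \<forall>j\<in>{1..n}. norm (z j \<omega>) \<le> L"
    and psd: "sym_psd E" and nonzero: "E \<noteq> 0" and EL: "spectral_norm E \<le> L\<^sup>2"
    and eigen: "ordered_eigensystem E l v"
begin

definition deviation :: "nat \<Rightarrow> 'a \<Rightarrow> real^'m^'m" where
  "deviation j \<omega> = outer (z j \<omega>) (z j \<omega>) - E"

definition deviation_sum :: "nat \<Rightarrow> 'a \<Rightarrow> real^'m^'m" where
  "deviation_sum j \<omega> = (\<Sum>i\<in>{1..j}. deviation i \<omega>)"

lemma deviation_sum_0: "deviation_sum 0 \<omega> = 0" and deviation_sum_Suc: "deviation_sum (Suc j) \<omega> = deviation_sum j \<omega> + deviation (Suc j) \<omega>"
  by (simp_all add: deviation_sum_def)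

lemma indep_deviation: "indep_vars (\<lambda>_. borel) deviation {1..n}"
  unfolding deviation_def[abs_def]
  by (rule indep_vars_compose2[OF indep, where Y = "\<lambda>_ z. outer z z - E"])
     (intro borel_measurable_continuous_onI continuous_on_diff continuous_on_outer continuous_intros)

lemma has_integral_deviation: "j \<in> {1..n} \<Longrightarrow> has_bochner_integral M (deviation j) 0"
  unfolding deviation_def[abs_def]
  using has_bochner_integral_diff[OF moment has_expectation_const[of E]] by simp

lemma has_integral_deviation_sum: "j \<le> n \<Longrightarrow> has_bochner_integral M (deviation_sum j) 0"
  unfolding deviation_sum_def[abs_def]
  using has_bochner_integral_sum[of "{1..j}" M deviation "\<lambda>_. 0"] has_integral_deviation by simp

lemma measurable_deviation_sum: "j \<le> n \<Longrightarrow> random_variable borel (deviation_sum j)"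
  using has_integral_deviation_sum has_bochner_integral_iff borel_measurable_integrable by blast

text \<open>A crude bound, meant only for integrability; its size does not enter the tail
  estimate.\<close>

lemma deviation_sum_bounded: "\<exists>K. AE \<omega> in M. \<forall>j\<le>n. norm (deviation_sum j \<omega>) \<le> K"
proof -
  obtain B where B: "\<And>x :: real^'m. norm x \<le> L \<Longrightarrow> norm (outer x x - E) \<le> B"
    using continuous_bounded_on_ball[OF continuous_on_diff[OF continuous_on_outer continuous_on_const], of L E]
    by blast
  have "AE \<omega> in M. \<forall>j\<le>n. norm (deviation_sum j \<omega>) \<le> real n * \<bar>B\<bar>"
    using bounded
  proof eventually_elim
    case (elim \<omega>)
    have "norm (deviation_sum j \<omega>) \<le> real n * \<bar>B\<bar>" if "j \<le> n" for j
    proof -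
      have "norm (deviation_sum j \<omega>) \<le> (\<Sum>i\<in>{1..j}. norm (deviation i \<omega>))"
        unfolding deviation_sum_def by (rule norm_sum)
      also have "\<dots> \<le> (\<Sum>i\<in>{1..j}. \<bar>B\<bar>)"
      proof (rule sum_mono)
        show "norm (deviation i \<omega>) \<le> \<bar>B\<bar>" if "i \<in> {1..j}" for i
          unfolding deviation_def using B[of "z i \<omega>"] elim that \<open>j \<le> n\<close> by fastforce
      qed
      also have "\<dots> \<le> real n * \<bar>B\<bar>"
        using that by (simp add: mult_right_mono)
      finally show ?thesis .
    qed
    thus ?case by blast
  qed
  thus ?thesis by blast
qed

lemma adj_deviation_sum: "adj (mat_endo (deviation_sum j \<omega>)) = mat_endo (deviation_sum j \<omega>)"
proof -
  have "adj (mat_endo (deviation i \<omega>)) = mat_endo (deviation i \<omega>)" for i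
    using psd by (simp add: deviation_def mat_endo_simps adj_mat_endo sym_psd_def)
  thus ?thesis
    by (induction j) (simp_all add: deviation_sum_0 deviation_sum_Suc mat_endo_simps)
qed

lemma spectral_norm_pos: "0 < spectral_norm E"
proof (rule ccontr)
  assume "\<not> ?thesis"
  hence "norm (mat_endo E) = 0"
    using spectral_norm_nonneg[of E] by (simp add: norm_mat_endo)
  hence "mat_endo E = 0" by simp
  hence "E *v x = 0" for x by (metis app_mat_endo app_simps(1))
  thus False using nonzero by (simp add: matrix_eq)
qed

definition Phi :: "real \<Rightarrow> nat \<Rightarrow> 'a \<Rightarrow> real" where
  "Phi \<tau> j \<omega> = exp_excess (mat_endo (\<tau> *\<^sub>R deviation_sum j \<omega>))"

lemma adj_scaled_deviation_sum: "adj (mat_endo (\<tau> *\<^sub>R deviation_sum j \<omega>)) = mat_endo (\<tau> *\<^sub>R deviation_sum j \<omega>)"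
  by (simp add: mat_endo_simps adj_deviation_sum)

lemma integrable_Phi:
  assumes "j \<le> n"
  shows "integrable M (Phi \<tau> j)"
proof -
  obtain K where "AE \<omega> in M. \<forall>j\<le>n. norm (deviation_sum j \<omega>) \<le> K" using deviation_sum_bounded by blast
  hence K: "AE \<omega> in M. norm (deviation_sum j \<omega>) \<le> K" by eventually_elim (use assms in simp)
  show ?thesis
    unfolding Phi_def[abs_def]
    by (rule integrable_continuous_bounded[OF _ measurable_deviation_sum[OF assms] K])
       (intro continuous_on_exp_excess continuous_on_mat_endo continuous_intros)
qed

text \<open>Two terms of the pointwise bound average to zero: the gradient depends on the past and
  meets an independent centred deviation, and the trace against \<open>F\<close> is linear in the
  centred partial sum.\<close>

lemma expectation_Phi_step:
  assumes j: "Suc j \<le> n" and \<tau>: "4 * \<bar>\<tau>\<bar> * L\<^sup>2 \<le> 1"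
  shows "expectation (Phi \<tau> (Suc j)) \<le>
    (1 + \<tau>\<^sup>2 * L\<^sup>2 * spectral_norm E) * expectation (Phi \<tau> j) + \<tau>\<^sup>2 * L\<^sup>2 * trace E"
proof -
  define F where "F = mat_endo E"
  define T where "T A D = tr (step_gradient \<tau> L F (mat_endo (\<tau> *\<^sub>R A)) * mat_endo D)" for A D :: "real^'m^'m"
  define R where "R A = tr (mat_endo (\<tau> *\<^sub>R A) * F)" for A :: "real^'m^'m"
  obtain K where "AE \<omega> in M. \<forall>j\<le>n. norm (deviation_sum j \<omega>) \<le> K" using deviation_sum_bounded by blast
  hence K: "AE \<omega> in M. norm (deviation_sum j \<omega>) \<le> K" by eventually_elim (use j in simp)
  have T: "has_bochner_integral M (\<lambda>\<omega>. T (deviation_sum j \<omega>) (deviation (Suc j) \<omega>)) 0"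
  proof (rule indep_centred_linear[OF _ K])
    have "indep_vars (\<lambda>_. borel) deviation (insert (Suc j) {1..j})"
      by (rule indep_vars_subset[OF indep_deviation]) (use j in auto)
    from indep_var_sum[OF _ _ this] show "indep_var borel (deviation_sum j) borel (deviation (Suc j))"
      by (simp add: deviation_sum_def[abs_def])
    show "has_bochner_integral M (deviation (Suc j)) 0" using j by (intro has_integral_deviation) auto
    show "linear (T A)" for A
      by (rule linearI) (simp_all add: T_def mat_endo_simps distrib_left)
    show "continuous_on UNIV (\<lambda>A. T A D)" for D
      unfolding T_def step_gradient_def
      by (intro bounded_linear.continuous_on[OF bounded_linear_tr] continuous_intros
          continuous_on_exp_banach continuous_on_mat_endo)
  qed
  have R: "has_bochner_integral M (\<lambda>\<omega>. R (deviation_sum j \<omega>)) 0"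
  proof -
    have "linear R"
      by (rule linearI) (simp_all add: R_def mat_endo_simps distrib_right scaleR_add_right)
    hence bl: "bounded_linear R" by (simp add: linear_conv_bounded_linear)
    show ?thesis
      using has_bochner_integral_bounded_linear[OF bl has_integral_deviation_sum[of j]] j linear_0[OF \<open>linear R\<close>] by simp
  qed
  define G where "G \<omega> = (1 + \<tau>\<^sup>2 * L\<^sup>2 * spectral_norm E) * Phi \<tau> j \<omega> + \<tau>\<^sup>2 * L\<^sup>2 * trace E
      + \<tau>\<^sup>2 * L\<^sup>2 * R (deviation_sum j \<omega>) + T (deviation_sum j \<omega>) (deviation (Suc j) \<omega>)" for \<omega>
  have "has_bochner_integral M (Phi \<tau> j) (expectation (Phi \<tau> j))"
    using integrable_Phi j by (simp add: has_bochner_integral_iff)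
  hence "has_bochner_integral M G ((1 + \<tau>\<^sup>2 * L\<^sup>2 * spectral_norm E) * expectation (Phi \<tau> j)
      + \<tau>\<^sup>2 * L\<^sup>2 * trace E + \<tau>\<^sup>2 * L\<^sup>2 * 0 + 0)"
    unfolding G_def
    by (intro has_bochner_integral_add has_bochner_integral_mult_right has_expectation_const R T)
  hence G: "integrable M G"
    "expectation G = (1 + \<tau>\<^sup>2 * L\<^sup>2 * spectral_norm E) * expectation (Phi \<tau> j) + \<tau>\<^sup>2 * L\<^sup>2 * trace E"
    by (simp_all add: has_bochner_integral_iff)
  have "expectation (Phi \<tau> (Suc j)) \<le> expectation G"
  proof (rule integral_mono_AE[OF integrable_Phi[OF j] G(1)])
    show "AE \<omega> in M. Phi \<tau> (Suc j) \<omega> \<le> G \<omega>"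
      using bounded
    proof eventually_elim
      case (elim \<omega>)
      hence "norm (z (Suc j) \<omega>) \<le> L" using j by auto
      from exp_excess_step[OF psd eigen EL this \<tau> adj_scaled_deviation_sum[of \<tau> j \<omega>]]
      show ?case
        by (simp add: Phi_def G_def deviation_sum_Suc mat_endo_simps scaleR_add_right R_def T_def F_def deviation_def)
    qed
  qed
  thus ?thesis by (simp add: G(2))
qed

text \<open>Solution of the affine recursion started at 0, once the trace of \<open>E\<close> is
  written as \<open>intdim E\<close> times the norm.\<close>

lemma expectation_Phi_le:
  assumes \<tau>: "4 * \<bar>\<tau>\<bar> * L\<^sup>2 \<le> 1" and "j \<le> n"
  shows "expectation (Phi \<tau> j) \<le> intdim E * ((1 + \<tau>\<^sup>2 * L\<^sup>2 * spectral_norm E) ^ j - 1)"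
  using \<open>j \<le> n\<close>
proof (induction j)
  case 0
  have "Phi \<tau> 0 = (\<lambda>_. 0)"
    by (simp add: fun_eq_iff Phi_def deviation_sum_0 mat_endo_simps exp_excess_def)
  thus ?case by simp
next
  case (Suc j)
  let ?a = "\<tau>\<^sup>2 * L\<^sup>2 * spectral_norm E"
  have "expectation (Phi \<tau> (Suc j)) \<le> (1 + ?a) * expectation (Phi \<tau> j) + \<tau>\<^sup>2 * L\<^sup>2 * trace E"
    by (rule expectation_Phi_step[OF Suc.prems \<tau>])
  also have "\<dots> \<le> (1 + ?a) * (intdim E * ((1 + ?a) ^ j - 1)) + \<tau>\<^sup>2 * L\<^sup>2 * trace E"
    using Suc spectral_norm_pos by (intro add_right_mono mult_left_mono) auto
  also have "\<tau>\<^sup>2 * L\<^sup>2 * trace E = ?a * intdim E"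
    using spectral_norm_pos by (simp add: intdim_def)
  also have "(1 + ?a) * (intdim E * ((1 + ?a) ^ j - 1)) + ?a * intdim E = intdim E * ((1 + ?a) ^ Suc j - 1)"
    by (simp add: algebra_simps)
  finally show ?case .
qed

lemma intdim_ge_1: "1 \<le> intdim E"
proof -
  have "1 \<in> {1..CARD('m)}" using one_le_card_finite by auto
  hence "norm (v 1) = 1" "l 1 = v 1 \<bullet> (E *v v 1)"
    using eigensystem_orthonormal[OF eigen] eigenvalue_eq_quadratic_form[OF eigen]
    by (auto simp: orthonormal_on_def norm_eq_1)
  moreover have "0 \<le> x \<bullet> app (mat_endo E) x" for x
    using psd by (simp add: sym_psd_def)
  ultimately have "l 1 \<le> trace E"
    using quadratic_form_le_tr[of "mat_endo E" "v 1"] by (simp add: tr_mat_endo)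
  thus ?thesis
    using spectral_norm_le_top_eigenvalue[OF psd eigen] spectral_norm_pos by (simp add: intdim_def)
qed

end

section \<open>Measurability of spectral data\<close>

lemma continuous_on_spectral_norm:
  fixes f :: "'b::topological_space \<Rightarrow> real^'m^'m"
  shows "continuous_on S f \<Longrightarrow> continuous_on S (\<lambda>x. spectral_norm (f x))"
  unfolding norm_mat_endo[symmetric] by (intro continuous_on_norm continuous_on_mat_endo)

lemma spectral_norm_0: "spectral_norm (0 :: real^'m^'m) = 0"
  by (simp add: norm_mat_endo[symmetric] mat_endo_simps)

lemma spectral_norm_diff_tendsto_0:
  fixes A :: "real^'m^'m"
  shows "((\<lambda>B. spectral_norm (A - B)) \<longlongrightarrow> 0) (at A within D)"
proof -
  have "continuous_on UNIV (\<lambda>B. spectral_norm (A - B))"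
    by (intro continuous_on_spectral_norm continuous_intros)
  hence "continuous (at A within D) (\<lambda>B. spectral_norm (A - B))"
    by (simp add: continuous_on_eq_continuous_at continuous_at_imp_continuous_within)
  thus ?thesis by (simp add: continuous_within spectral_norm_0)
qed

text \<open>
  The functions \<open>lh\<close> and \<open>vh\<close> are arbitrary selections of an eigensystem and \<open>vh\<close> need not be
  measurable. Perturbation theory shows that the eigenvalues, and the dominant eigenspace where there
  is a gap, depend only on the matrix and do so continuously.
\<close>

lemma measurable_eigenvalue:
  fixes H :: "'a \<Rightarrow> real^'m^'m"
  assumes H: "H \<in> borel_measurable M" and i: "i \<in> {1..CARD('m)}"
    and es: "\<And>\<omega>. \<omega> \<in> space M \<Longrightarrow> ordered_eigensystem (H \<omega>) (lh \<omega>) (vh \<omega>)"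
  shows "(\<lambda>\<omega>. lh \<omega> i) \<in> borel_measurable M"
proof -
  define D where "D = {A :: real^'m^'m. \<exists>l v. ordered_eigensystem A l v}"
  \<comment> \<open>A selection that depends on the matrix alone. Weyl with both matrices equal
    shows that it agrees with any other eigensystem, so \<open>lh\<close> factors through
    \<open>F\<close>.\<close>
  define F where "F A = (SOME l. \<exists>v. ordered_eigensystem A l v) i" for A :: "real^'m^'m"
  have close: "\<bar>l i - m i\<bar> \<le> spectral_norm (A - B)"
    if "ordered_eigensystem A l v" "ordered_eigensystem B m u" for A B :: "real^'m^'m" and l m v u
    using Weyl_eigenvalue_perturbation[OF that i] Weyl_eigenvalue_perturbation[OF that(2,1) i]
    by (simp add: spectral_norm_minus_commute[of B A])
  have F: "F A = l i" if "ordered_eigensystem A l v" for A l v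
  proof -
    have "\<exists>v. ordered_eigensystem A (SOME l. \<exists>v. ordered_eigensystem A l v) v"
      using that by (intro someI[where P = "\<lambda>l. \<exists>v. ordered_eigensystem A l v"] exI)
    then obtain u where "ordered_eigensystem A (SOME l. \<exists>v. ordered_eigensystem A l v) u" ..
    from close[OF this that] show ?thesis by (simp add: F_def spectral_norm_0)
  qed
  have "continuous_on D F"
    unfolding continuous_on_def
  proof
    fix A assume "A \<in> D"
    then obtain l v where A: "ordered_eigensystem A l v" by (auto simp: D_def)
    have "\<forall>\<^sub>F B in at A within D. norm (F B - F A) \<le> spectral_norm (A - B)"
      unfolding eventually_at_filter
    proof (intro always_eventually allI impI)
      fix B assume "B \<in> D"
      then obtain m u where B: "ordered_eigensystem B m u" by (auto simp: D_def)
      show "norm (F B - F A) \<le> spectral_norm (A - B)"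
        using close[OF A B] by (simp add: F[OF A] F[OF B] abs_minus_commute)
    qed
    from Lim_null_comparison[OF this spectral_norm_diff_tendsto_0]
    show "(F \<longlongrightarrow> F A) (at A within D)" by (rule LIM_zero_cancel)
  qed
  hence "F \<in> borel_measurable (restrict_space borel D)"
    by (rule borel_measurable_continuous_on_restrict)
  moreover have "H \<in> measurable M (restrict_space borel D)"
    by (rule measurable_restrict_space2[OF _ H]) (use es in \<open>auto simp: D_def\<close>)
  ultimately have "(\<lambda>\<omega>. F (H \<omega>)) \<in> borel_measurable M"
    by (rule measurable_compose[rotated])
  thus ?thesis
    by (rule measurable_cong[THEN iffD1, rotated]) (use F es in auto)
qed

text \<open>\<open>measure\<close> is 0 on non-measurable sets, so a lower bound for this event
  requires its measurability. The gap event is measurable by the eigenvalue lemma; on it the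
  projector is a continuous function of the matrix.\<close>

lemma dominant_subspace_event_measurable:
  fixes H :: "'a \<Rightarrow> real^'m^'m" and P :: "real^'m^'m"
  assumes H: "H \<in> borel_measurable M" and k: "1 \<le> k" "k < CARD('m)"
    and es: "\<And>\<omega>. \<omega> \<in> space M \<Longrightarrow> ordered_eigensystem (H \<omega>) (lh \<omega>) (vh \<omega>)"
  shows "{\<omega> \<in> space M. lh \<omega> (k + 1) < lh \<omega> k \<and>
    spectral_norm (P - orth_proj (span (vh \<omega> ` {1..k}))) \<le> c} \<in> sets M"
proof -
  define \<Omega> where "\<Omega> = {\<omega> \<in> space M. lh \<omega> (k + 1) < lh \<omega> k}"
  have \<Omega>: "\<Omega> \<in> sets M"
    unfolding \<Omega>_def using k
    by (intro borel_measurable_less measurable_eigenvalue[OF H _ es]) auto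
  define d where "d v = spectral_norm (P - orth_proj (span (v ` {1..k})))" for v :: "nat \<Rightarrow> real^'m"
  define D where "D = {A :: real^'m^'m. \<exists>l v. ordered_eigensystem A l v \<and> l (k + 1) < l k}"
  define F where "F A = d (SOME v. \<exists>l. ordered_eigensystem A l v)" for A :: "real^'m^'m"
  have close: "\<bar>d u - d v\<bar> \<le> 2 * spectral_norm (A - B) / (l k - l (k + 1))"
    if "ordered_eigensystem A l v" "ordered_eigensystem B m u" "2 * spectral_norm (A - B) < l k - l (k + 1)"
    for A B :: "real^'m^'m" and l m v u
  proof -
    let ?V = "orth_proj (span (v ` {1..k}))" and ?U = "orth_proj (span (u ` {1..k}))"
    have "\<bar>d u - d v\<bar> \<le> spectral_norm (?V - ?U)"
      using norm_triangle_ineq3[of "mat_endo (P - ?U)" "mat_endo (P - ?V)"]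
      by (simp add: d_def mat_endo_simps[symmetric] norm_mat_endo)
    also have "\<dots> \<le> 2 * spectral_norm (A - B) / (l k - l (k + 1))"
      by (rule dominant_subspace_perturbation(2)[OF that(1,2) k that(3)])
    finally show ?thesis .
  qed
  have F: "F A = d v" if "ordered_eigensystem A l v" "l (k + 1) < l k" for A l v
  proof -
    have "\<exists>l. ordered_eigensystem A l (SOME v. \<exists>l. ordered_eigensystem A l v)"
      using that by (intro someI[where P = "\<lambda>v. \<exists>l. ordered_eigensystem A l v"] exI)
    then obtain m where "ordered_eigensystem A m (SOME v. \<exists>l. ordered_eigensystem A l v)" ..
    from close[OF that(1) this] that(2) show ?thesis by (simp add: F_def spectral_norm_0)
  qed
  have "continuous_on D F"
    unfolding continuous_on_def
  proof
    fix A assume "A \<in> D"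
    then obtain l v where A: "ordered_eigensystem A l v" and gap: "l (k + 1) < l k" by (auto simp: D_def)
    let ?b = "\<lambda>B. 2 * spectral_norm (A - B) / (l k - l (k + 1))"
    have "((\<lambda>B. 2 * spectral_norm (A - B)) \<longlongrightarrow> 2 * 0) (at A within D)"
      by (intro tendsto_intros spectral_norm_diff_tendsto_0)
    hence "\<forall>\<^sub>F B in at A within D. 2 * spectral_norm (A - B) < l k - l (k + 1)"
      by (rule order_tendstoD(2)) (use gap in simp)
    moreover have "\<forall>\<^sub>F B in at A within D. B \<in> D"
      unfolding eventually_at_filter by simp
    ultimately have "\<forall>\<^sub>F B in at A within D. norm (F B - F A) \<le> ?b B"
    proof eventually_elim
      case (elim B)
      then obtain m u where B: "ordered_eigensystem B m u" "m (k + 1) < m k" by (auto simp: D_def)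
      show ?case
        using close[OF A B(1) elim(1)] by (simp add: F[OF A gap] F[OF B])
    qed
    moreover have "(?b \<longlongrightarrow> 2 * 0 / (l k - l (k + 1))) (at A within D)"
      by (intro tendsto_intros spectral_norm_diff_tendsto_0) (use gap in simp)
    hence "(?b \<longlongrightarrow> 0) (at A within D)" by simp
    ultimately have "((\<lambda>B. F B - F A) \<longlongrightarrow> 0) (at A within D)"
      by (rule Lim_null_comparison)
    thus "(F \<longlongrightarrow> F A) (at A within D)" by (rule LIM_zero_cancel)
  qed
  hence "F \<in> borel_measurable (restrict_space borel D)"
    by (rule borel_measurable_continuous_on_restrict)
  moreover have "H \<in> measurable (restrict_space M \<Omega>) (restrict_space borel D)"
    by (rule measurable_restrict_space2[OF _ measurable_restrict_space1[OF H]])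
       (use es in \<open>auto simp: D_def \<Omega>_def space_restrict_space\<close>)
  ultimately have "(\<lambda>\<omega>. F (H \<omega>)) \<in> borel_measurable (restrict_space M \<Omega>)"
    by (rule measurable_compose[rotated])
  hence "{\<omega> \<in> space (restrict_space M \<Omega>). F (H \<omega>) \<le> c} \<in> sets (restrict_space M \<Omega>)"
    by (rule borel_measurable_le) simp
  hence "{\<omega> \<in> space (restrict_space M \<Omega>). F (H \<omega>) \<le> c} \<in> sets M"
    using \<Omega> by (simp add: sets_restrict_space_iff)
  moreover have "{\<omega> \<in> space (restrict_space M \<Omega>). F (H \<omega>) \<le> c} = {\<omega> \<in> space M. lh \<omega> (k + 1) < lh \<omega> k \<and> d (vh \<omega>) \<le> c}"
    using F[OF es] by (auto simp: \<Omega>_def space_restrict_space)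
  ultimately show ?thesis by (simp add: d_def)
qed

section \<open>Tail bounds\<close>

text \<open>Polarisation: with \<open>y\<close> the image A x rescaled to the length of
  \<open>x\<close>, the forms at x + y and x - y differ by 4 |x| |A x|, and the parallelogram law
  bounds them.\<close>

lemma symmetric_spectral_norm_le:
  fixes A :: "real^'m^'m"
  assumes sym: "transpose A = A" and q: "\<And>x. norm x = 1 \<Longrightarrow> \<bar>x \<bullet> (A *v x)\<bar> \<le> b" and "0 \<le> b"
  shows "spectral_norm A \<le> b"
proof (rule spectral_norm_le[OF \<open>0 \<le> b\<close>])
  fix x
  have q': "\<bar>y \<bullet> (A *v y)\<bar> \<le> b * (norm y)\<^sup>2" for y
  proof (cases "y = 0")
    case False
    have "\<bar>(y /\<^sub>R norm y) \<bullet> (A *v (y /\<^sub>R norm y))\<bar> \<le> b"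
      using False by (intro q) simp
    thus ?thesis
      using False by (simp add: matrix_vector_mult_scaleR abs_mult field_simps power2_eq_square)
  qed simp
  have s: "y \<bullet> (A *v w) = w \<bullet> (A *v y)" for y w
    using sym by (metis dot_lmul_matrix inner_commute transpose_matrix_vector)
  show "norm (A *v x) \<le> b * norm x"
  proof (cases "x = 0 \<or> A *v x = 0")
    case True
    thus ?thesis using \<open>0 \<le> b\<close> by auto
  next
    case False
    define y where "y = (norm x / norm (A *v x)) *\<^sub>R (A *v x)"
    have ny: "norm y = norm x" using False by (simp add: y_def)
    have "y \<bullet> (A *v x) = norm x * norm (A *v x)"
      using False by (simp add: y_def dot_square_norm power2_eq_square)
    hence "4 * (norm x * norm (A *v x)) = (x + y) \<bullet> (A *v (x + y)) - (x - y) \<bullet> (A *v (x - y))"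
      by (simp add: matrix_vector_right_distrib matrix_vector_mult_diff_distrib inner_add_left inner_diff_left
          inner_add_right inner_diff_right s[of x y])
    also have "\<dots> \<le> b * (norm (x + y))\<^sup>2 + b * (norm (x - y))\<^sup>2"
      using q'[of "x + y"] q'[of "x - y"] by linarith
    also have "\<dots> = b * (2 * (norm x)\<^sup>2 + 2 * (norm y)\<^sup>2)"
      by (simp add: power2_norm_eq_inner inner_add_left inner_diff_left inner_add_right inner_diff_right
          inner_commute algebra_simps)
    also have "\<dots> = 4 * (norm x * (b * norm x))"
      by (simp add: ny power2_eq_square)
    finally show ?thesis using False by simp
  qed
qed

lemma exp_minus_id_mono: "0 \<le> s \<Longrightarrow> s \<le> t \<Longrightarrow> exp s - 1 - s \<le> exp t - 1 - (t :: real)"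
proof -
  assume st: "0 \<le> s" "s \<le> t"
  have "t - s \<le> exp (t - s) - 1"
    using exp_ge_add_one_self[of "t - s"] by linarith
  hence "1 * (t - s) \<le> exp s * (exp (t - s) - 1)"
    using st by (intro mult_mono) auto
  also have "\<dots> = exp t - exp s"
    by (simp add: right_diff_distrib exp_add[symmetric])
  finally show ?thesis by simp
qed

context second_moment_sample
begin

text \<open>Markov's inequality with mean at most intdim(E) e^u, at the level that an eigenvalue 2u
  would force.\<close>

lemma Phi_tail:
  assumes \<tau>: "4 * \<bar>\<tau>\<bar> * L\<^sup>2 \<le> 1" and u: "u = real n * (\<tau>\<^sup>2 * L\<^sup>2 * spectral_norm E)" "2 \<le> u"
  shows "prob {\<omega> \<in> space M. exp (2 * u) - 1 - 2 * u \<le> Phi \<tau> n \<omega>} \<le> 2 * intdim E * exp (- u)"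
proof -
  let ?c = "exp (2 * u) - 1 - 2 * u" and ?a = "\<tau>\<^sup>2 * L\<^sup>2 * spectral_norm E"
  \<comment> \<open>Here \<open>2 \<le> u\<close> enters: the subtracted linear part costs at most
    half of the exponential.\<close>
  have "2 * u + 1 \<le> exp (2 * u) / 2"
  proof -
    have "2 * 2 \<le> u * u" using u(2) by (intro mult_mono) auto
    moreover have "1 + 2 * u + (2 * u)\<^sup>2 / 2 \<le> exp (2 * u)"
      using u(2) by (intro exp_lower_Taylor_quadratic) simp
    moreover have "2 * u \<le> u * u" using u(2) by (intro mult_right_mono) auto
    ultimately show ?thesis by (simp add: power2_eq_square)
  qed
  hence c: "exp (2 * u) / 2 \<le> ?c" by simp
  hence c0: "0 < ?c" by (rule less_le_trans[rotated]) simp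
  have "prob {\<omega> \<in> space M. ?c \<le> Phi \<tau> n \<omega>} \<le> expectation (Phi \<tau> n) / ?c"
    by (rule integral_Markov_inequality_measure[OF integrable_Phi sets.top _ c0])
       (auto simp: Phi_def intro!: exp_excess_nonneg adj_scaled_deviation_sum)
  also have "\<dots> \<le> (intdim E * exp u) / ?c"
  proof (rule divide_right_mono)
    have "(1 + ?a) ^ n \<le> exp ?a ^ n"
      using spectral_norm_pos by (intro power_mono) (auto simp: exp_ge_add_one_self)
    also have "\<dots> = exp u" by (simp add: u(1) exp_of_nat_mult)
    finally have "(1 + ?a) ^ n - 1 \<le> exp u" by simp
    hence "intdim E * ((1 + ?a) ^ n - 1) \<le> intdim E * exp u"
      using intdim_ge_1 by (intro mult_left_mono) auto
    thus "expectation (Phi \<tau> n) \<le> intdim E * exp u"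
      using expectation_Phi_le[OF \<tau> order_refl] by linarith
  qed (use c0 in simp)
  also have "\<dots> \<le> (intdim E * exp u) / (exp (2 * u) / 2)"
    using c intdim_ge_1 c0 by (intro divide_left_mono mult_nonneg_nonneg mult_pos_pos) auto
  also have "\<dots> = 2 * intdim E * (exp u / exp (2 * u))" by simp
  also have "exp u / exp (2 * u) = exp (- u)"
    by (simp add: exp_diff[symmetric])
  finally show ?thesis .
qed

text \<open>Contrapositive: a larger value of the form would lift \<open>Phi\<close> to the
  threshold, since exp s - 1 - s increases for nonnegative s. The two signs of \<tau> give the two
  sides of the absolute value.\<close>

lemma quadratic_form_deviation_sum_le:
  assumes "0 \<le> s" "Phi \<tau> n \<omega> < exp s - 1 - s" "norm x = 1"
  shows "\<tau> * (x \<bullet> (deviation_sum n \<omega> *v x)) \<le> s"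
proof (rule ccontr)
  let ?q = "\<tau> * (x \<bullet> (deviation_sum n \<omega> *v x))"
  assume "\<not> ?thesis"
  hence "exp s - 1 - s \<le> exp ?q - 1 - ?q"
    using assms(1) by (intro exp_minus_id_mono) auto
  also have "\<dots> \<le> Phi \<tau> n \<omega>"
    using exp_excess_ge[OF adj_scaled_deviation_sum assms(3), of \<tau> n \<omega>]
    by (simp add: Phi_def scaleR_matrix_vector_assoc[symmetric])
  finally show False using assms(2) by simp
qed

lemma second_moment_concentration:
  assumes n: "1 \<le> n" and L: "0 < L" and \<epsilon>: "0 < \<epsilon>" "\<epsilon> \<le> 1 / 4" and \<delta>: "0 < \<delta>" "\<delta> < 1"
    and N: "8 / (3 * \<epsilon>\<^sup>2) * (L\<^sup>2 / spectral_norm E) * ln (4 / \<delta> * intdim E) \<le> real n"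
  shows "\<exists>G \<in> sets M. 1 - \<delta> \<le> prob G \<and>
    (\<forall>\<omega>\<in>G. spectral_norm (sample_second_moment n (\<lambda>j. z j \<omega>) - E) \<le> 2 * spectral_norm E * \<epsilon>)"
proof -
  let ?e = "spectral_norm E"
  note e = spectral_norm_pos
  define \<tau> where "\<tau> = \<epsilon> / L\<^sup>2"
  define u where "u = real n * (\<tau>\<^sup>2 * L\<^sup>2 * ?e)"
  let ?c = "exp (2 * u) - 1 - 2 * u"
  have \<tau>0: "0 < \<tau>" using \<epsilon> L by (simp add: \<tau>_def)
  have \<tau>1: "4 * \<bar>\<tau>\<bar> * L\<^sup>2 \<le> 1" "4 * \<bar>- \<tau>\<bar> * L\<^sup>2 \<le> 1"
    using \<epsilon> L by (simp_all add: \<tau>_def)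
  have u_eq: "u = real n * \<epsilon>\<^sup>2 * ?e / L\<^sup>2"
    using L by (simp add: u_def \<tau>_def power2_eq_square field_simps)
  let ?q = "4 / \<delta> * intdim E"
  have q4: "4 \<le> ?q"
    using \<delta> mult_mono[OF _ intdim_ge_1, of 4 "4 / \<delta>"] by (simp add: field_simps)
  have "1 \<le> ln (4 :: real)"
    using exp_le by (subst ln_ge_iff) auto
  also have "\<dots> \<le> ln ?q" using q4 by simp
  finally have lnq: "1 \<le> ln ?q" .
  have "8 / (3 * \<epsilon>\<^sup>2) * (L\<^sup>2 / ?e) * ln ?q * (\<epsilon>\<^sup>2 * ?e / L\<^sup>2) \<le> real n * (\<epsilon>\<^sup>2 * ?e / L\<^sup>2)"
    using N e by (intro mult_right_mono) auto
  \<comment> \<open>Since the logarithm is at least 1, the factor 8/3 secures both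
    \<open>2 \<le> u\<close> for the tail bound and \<open>ln ?q \<le> u\<close> for the failure
    probability.\<close>
  hence u83: "8 / 3 * ln ?q \<le> u"
    using \<epsilon> L e by (simp add: u_eq power2_eq_square)
  hence u2: "2 \<le> u" and uq: "ln ?q \<le> u" using lnq by linarith+
  define B where "B s = {\<omega> \<in> space M. ?c \<le> Phi s n \<omega>}" for s
  have [measurable]: "Phi s n \<in> borel_measurable M" for s
    using integrable_Phi[of n s] by simp
  have B: "B s \<in> sets M" for s unfolding B_def by measurable
  have pB: "prob (B \<tau>) \<le> 2 * intdim E * exp (- u)" "prob (B (- \<tau>)) \<le> 2 * intdim E * exp (- u)"
    unfolding B_def by (rule Phi_tail; use \<tau>1 u_def u2 in simp)+
  have "exp (- u) \<le> exp (- ln ?q)" using uq by simp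
  also have "\<dots> = 1 / ?q" using q4 by (simp add: exp_minus inverse_eq_divide)
  finally have "4 * intdim E * exp (- u) \<le> 4 * intdim E * (1 / ?q)"
    using intdim_ge_1 by (intro mult_left_mono) auto
  also have "\<dots> = \<delta>" using intdim_ge_1 \<delta> by (simp add: field_simps)
  finally have "prob (B \<tau> \<union> B (- \<tau>)) \<le> \<delta>"
    using pB measure_Un_le[OF B B, of \<tau> "- \<tau>"] by linarith
  define G where "G = space M - (B \<tau> \<union> B (- \<tau>))"
  have "G \<in> sets M" unfolding G_def using B by blast
  moreover have "1 - \<delta> \<le> prob G"
    unfolding G_def using B \<open>prob (B \<tau> \<union> B (- \<tau>)) \<le> \<delta>\<close> by (subst prob_compl) auto
  moreover have "spectral_norm (sample_second_moment n (\<lambda>j. z j \<omega>) - E) \<le> 2 * ?e * \<epsilon>" if "\<omega> \<in> G" for \<omega>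
  proof -
    have small: "Phi \<tau> n \<omega> < ?c" "Phi (- \<tau>) n \<omega> < ?c"
      using that by (auto simp: G_def B_def)
    have S_eq: "sample_second_moment n (\<lambda>j. z j \<omega>) - E = (1 / real n) *\<^sub>R deviation_sum n \<omega>"
    proof -
      have "deviation_sum n \<omega> = (\<Sum>j = 1..n. outer (z j \<omega>) (z j \<omega>)) - real n *\<^sub>R E"
        by (simp add: deviation_sum_def deviation_def sum_subtractf sum_constant_scaleR del: sum_constant)
      thus ?thesis using n by (simp add: sample_second_moment_def scaleR_diff_right)
    qed
    show ?thesis
    proof (rule symmetric_spectral_norm_le)
      have tS: "transpose (deviation_sum n \<omega>) = deviation_sum n \<omega>"
      proof -
        have "mat_endo (transpose (deviation_sum n \<omega>) - deviation_sum n \<omega>) = 0"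
          using adj_deviation_sum[of n \<omega>] by (simp add: mat_endo_simps adj_mat_endo)
        hence "transpose (deviation_sum n \<omega>) *v x = deviation_sum n \<omega> *v x" for x
          by (metis app_mat_endo app_simps(1) eq_iff_diff_eq_0 matrix_vector_mult_diff_rdistrib)
        thus ?thesis by (simp add: matrix_eq)
      qed
      thus "transpose (sample_second_moment n (\<lambda>j. z j \<omega>) - E) = sample_second_moment n (\<lambda>j. z j \<omega>) - E"
        unfolding S_eq by (simp add: transpose_scalar)
      show "0 \<le> 2 * ?e * \<epsilon>" using e \<epsilon> by simp
      fix x :: "real^'m" assume x: "norm x = 1"
      have "\<tau> * (x \<bullet> (deviation_sum n \<omega> *v x)) \<le> 2 * u" "- \<tau> * (x \<bullet> (deviation_sum n \<omega> *v x)) \<le> 2 * u"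
        by (rule quadratic_form_deviation_sum_le[OF _ small(1) x] quadratic_form_deviation_sum_le[OF _ small(2) x]; use u2 in simp)+
      hence "\<tau> * \<bar>x \<bullet> (deviation_sum n \<omega> *v x)\<bar> \<le> 2 * u"
        by (simp add: abs_if)
      \<comment> \<open>One factor \<tau> of \<open>u\<close> cancels; the other combines with L^2
        to \<epsilon>.\<close>
      also have "2 * u = \<tau> * (real n * (2 * ?e * \<epsilon>))"
        using L by (simp add: u_def \<tau>_def power2_eq_square)
      finally have "\<bar>x \<bullet> (deviation_sum n \<omega> *v x)\<bar> \<le> real n * (2 * ?e * \<epsilon>)"
        using \<tau>0 by simp
      thus "\<bar>x \<bullet> ((sample_second_moment n (\<lambda>j. z j \<omega>) - E) *v x)\<bar> \<le> 2 * ?e * \<epsilon>"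
        unfolding S_eq using n by (simp add: scaleR_matrix_vector_assoc[symmetric] abs_mult field_simps)
    qed
  qed
  ultimately show ?thesis by blast
qed

end

theorem theorem2p3:
  fixes M :: "'a measure"
    and E :: "real^'m^'m"
    and z :: "nat \<Rightarrow> 'a \<Rightarrow> real^'m"
    and n k :: nat
    and L \<epsilon> \<delta> :: real
    and l :: "nat \<Rightarrow> real" and v :: "nat \<Rightarrow> real^'m"
    and lh :: "'a \<Rightarrow> nat \<Rightarrow> real" and vh :: "'a \<Rightarrow> nat \<Rightarrow> real^'m"
  assumes "prob_space M"
    and "1 \<le> n"
    and "sym_psd E" and "E \<noteq> 0"
    and "prob_space.indep_vars M (\<lambda>_. borel) z {1..n}"
    and "\<And>j. j \<in> {1..n} \<Longrightarrow>
           has_bochner_integral M (\<lambda>\<omega>. outer (z j \<omega>) (z j \<omega>)) E"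
    and "0 < L"
    and "AE \<omega> in M. \<forall>j\<in>{1..n}. norm (z j \<omega>) \<le> L"
    and "spectral_norm E \<le> L\<^sup>2"
    and "ordered_eigensystem E l v"
    and "\<And>\<omega>. \<omega> \<in> space M \<Longrightarrow>
           ordered_eigensystem (sample_second_moment n (\<lambda>j. z j \<omega>)) (lh \<omega>) (vh \<omega>)"
    and "1 \<le> k" and "k < CARD('m)"
    and "l k - l (k + 1) > 0"
    and "0 < \<epsilon>" and "\<epsilon> < (l k - l (k + 1)) / (4 * spectral_norm E)"
    and "0 < \<delta>" and "\<delta> < 1"
    and "real n \<ge> 8 / (3 * \<epsilon>\<^sup>2) * (L\<^sup>2 / spectral_norm E) * ln (4 / \<delta> * intdim E)"
  shows "measure M {\<omega> \<in> space M. lh \<omega> k > lh \<omega> (k + 1) \<and>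
           sin (largest_principal_angle (span (vh \<omega> ` {1..k})) (span (v ` {1..k})))
             \<le> 4 * spectral_norm E / (l k - l (k + 1)) * \<epsilon>} \<ge> 1 - \<delta>"
proof -
  interpret prob_space M by fact
  interpret second_moment_sample M z n E L l v
    by unfold_locales fact+
  let ?gap = "l k - l (k + 1)" and ?H = "\<lambda>\<omega>. sample_second_moment n (\<lambda>j. z j \<omega>)"
  let ?P = "\<lambda>v. orth_proj (span (v ` {1..k}))"
  note e = spectral_norm_pos
  have kI: "k \<in> {1..CARD('m)}" "k + 1 \<in> {1..CARD('m)}" using assms(12,13) by auto
  have "l k \<le> spectral_norm E"
    using quadratic_form_le_spectral_norm[of "v k" E] eigenvalue_eq_quadratic_form[OF eigen kI(1)]
      eigensystem_orthonormal[OF eigen] kI(1) by (auto simp: orthonormal_on_def power2_norm_eq_inner)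
  \<comment> \<open>\<open>l k\<close> is at most the norm and \<open>l (k + 1)\<close> is
    nonnegative; with the bound on \<epsilon> this gives the 1/4 needed for concentration.\<close>
  hence gap_le: "?gap \<le> spectral_norm E"
    using psd_eigenvalue_nonneg[OF psd eigen kI(2)] by simp
  have gap: "4 * spectral_norm E * \<epsilon> < ?gap"
    using assms(16) e by (simp add: field_simps)
  have "spectral_norm E * (4 * \<epsilon>) \<le> spectral_norm E * 1" using gap gap_le by simp
  hence \<epsilon>4: "\<epsilon> \<le> 1 / 4" using e by simp
  obtain G where G: "G \<in> sets M" "1 - \<delta> \<le> prob G"
    and close: "\<And>\<omega>. \<omega> \<in> G \<Longrightarrow> spectral_norm (?H \<omega> - E) \<le> 2 * spectral_norm E * \<epsilon>"
    using second_moment_concentration[OF assms(2,7,15) \<epsilon>4 assms(17,18,19)] by blast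
  let ?T = "{\<omega> \<in> space M. lh \<omega> (k + 1) < lh \<omega> k \<and> spectral_norm (?P v - ?P (vh \<omega>)) \<le> 4 * spectral_norm E / ?gap * \<epsilon>}"
  have angle: "sin (largest_principal_angle (span (vh \<omega> ` {1..k})) (span (v ` {1..k}))) = spectral_norm (?P v - ?P (vh \<omega>))" for \<omega>
    by (rule sin_largest_principal_angle) auto
  have "?H \<in> borel_measurable M"
  proof -
    have [measurable]: "(\<lambda>\<omega>. outer (z j \<omega>) (z j \<omega>)) \<in> borel_measurable M" if "j \<in> {1..n}" for j
      using moment[OF that] has_bochner_integral_iff borel_measurable_integrable by blast
    show ?thesis unfolding sample_second_moment_def by (intro borel_measurable_scaleR borel_measurable_sum) auto
  qed
  from dominant_subspace_event_measurable[OF this assms(12,13,11)]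
  have T: "?T \<in> sets M" by blast
  have "G \<subseteq> ?T"
  proof
    fix \<omega> assume \<omega>: "\<omega> \<in> G"
    hence sp: "\<omega> \<in> space M" using G(1) sets.sets_into_space by auto
    have c: "spectral_norm (E - ?H \<omega>) \<le> 2 * spectral_norm E * \<epsilon>"
      using close[OF \<omega>] by (simp add: spectral_norm_minus_commute)
    \<comment> \<open>Twice the deviation is at most 4 |E| \<epsilon>, and the upper bound on
      \<epsilon> places this strictly below the gap.\<close>
    hence "2 * spectral_norm (E - ?H \<omega>) < ?gap" using gap by linarith
    from dominant_subspace_perturbation[OF eigen assms(11)[OF sp] assms(12,13) this]
    have "lh \<omega> (k + 1) < lh \<omega> k" "spectral_norm (?P v - ?P (vh \<omega>)) \<le> 2 * spectral_norm (E - ?H \<omega>) / ?gap"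
      by auto
    moreover have "2 * spectral_norm (E - ?H \<omega>) / ?gap \<le> 2 * (2 * spectral_norm E * \<epsilon>) / ?gap"
      using c assms(14) by (intro divide_right_mono mult_left_mono) auto
    ultimately show "\<omega> \<in> ?T" using sp by simp
  qed
  hence "prob G \<le> prob ?T" using T by (rule finite_measure_mono)
  thus ?thesis using G(2) unfolding angle by linarith
qed

end
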